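(* Let $p$ be an odd prime. Suppose that either $p = 40k_1 + 3$ for some integer $k_1$ such that $5k_1+1$ is a perfect square, or $p = 40k_2+27$ for some integer $k_2$ such that $5k_2+4$ is a perfect square. Then the elliptic curve $E_p : y^2 = x^3 - 5px$ has rank exactly one over $\mathbb{Q}$.
   Context: The rank of an elliptic curve $E$ over a field $K$ is the rank $r$ of the finitely generated abelian group $E(K) \cong \mathbb{Z}^r \oplus E(K)_{\mathrm{tors}}$. *)

theory Defs
  imports "HOL-Algebra.Product_Groups" "HOL-Computational_Algebra.Primes" Complex_Main
begin

section \<open>Elliptic curves in short Weierstrass form\<close>

definition elliptic_curve :: "'a::field \<Rightarrow> 'a \<Rightarrow> bool" where
  "elliptic_curve a b \<longleftrightarrow> - 16 * (4 * a ^ 3 + 27 * b ^ 2) \<noteq> 0"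

text \<open>
  A pair \<open>(a, b)\<close> stands for \<open>y\<^sup>2 = x\<^sup>3 + a x + b\<close>. The factor 16 of the discriminant is kept
  because it rules out characteristic 2, where this equation is always singular.
\<close>

datatype 'a point = Infinity | Affine 'a 'a

fun on_curve :: "'a::field \<Rightarrow> 'a \<Rightarrow> 'a point \<Rightarrow> bool" where
  "on_curve a b Infinity \<longleftrightarrow> True"
| "on_curve a b (Affine x y) \<longleftrightarrow> y ^ 2 = x ^ 3 + a * x + b"

text \<open>
  Chord-and-tangent addition. Only \<open>a\<close> enters the formulas. In the tangent case both points lie
  on the curve, have the same abscissa and are not opposite, so they coincide and \<open>y\<^sub>1 \<noteq> 0\<close>.
\<close>

fun ec_add :: "'a::field \<Rightarrow> 'a point \<Rightarrow> 'a point \<Rightarrow> 'a point" where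
  "ec_add a Infinity Q = Q"
| "ec_add a P Infinity = P"
| "ec_add a (Affine x\<^sub>1 y\<^sub>1) (Affine x\<^sub>2 y\<^sub>2) =
     (if x\<^sub>1 = x\<^sub>2 \<and> y\<^sub>1 = - y\<^sub>2 then Infinity
      else let m = (if x\<^sub>1 = x\<^sub>2 then (3 * x\<^sub>1 ^ 2 + a) / (2 * y\<^sub>1) else (y\<^sub>2 - y\<^sub>1) / (x\<^sub>2 - x\<^sub>1));
               x\<^sub>3 = m ^ 2 - x\<^sub>1 - x\<^sub>2
           in Affine x\<^sub>3 (m * (x\<^sub>1 - x\<^sub>3) - y\<^sub>1))"

definition ec_group :: "'a::field \<Rightarrow> 'a \<Rightarrow> 'a point monoid" where
  "ec_group a b = \<lparr>carrier = {P. on_curve a b P}, monoid.mult = ec_add a, one = Infinity\<rparr>"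

section \<open>Rank of a finitely generated abelian group\<close>

definition finitely_generated_group :: "('g, 'm) monoid_scheme \<Rightarrow> bool" where
  "finitely_generated_group G \<longleftrightarrow> (\<exists>S. finite S \<and> S \<subseteq> carrier G \<and> generate G S = carrier G)"

definition torsion_group :: "('g, 'm) monoid_scheme \<Rightarrow> ('g, 'm) monoid_scheme" where
  "torsion_group G = G\<lparr>carrier := {x \<in> carrier G. \<exists>n::nat. n > 0 \<and> x [^]\<^bsub>G\<^esub> n = \<one>\<^bsub>G\<^esub>}\<rparr>"

definition has_rank :: "('g, 'm) monoid_scheme \<Rightarrow> nat \<Rightarrow> bool" where
  "has_rank G r \<longleftrightarrow> comm_group G \<and> finitely_generated_group G \<and>
     G \<cong> product_group {..<r} (\<lambda>_. integer_group) \<times>\<times> torsion_group G"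

definition ec_has_rank :: "'a::field \<Rightarrow> 'a \<Rightarrow> nat \<Rightarrow> bool" where
  "ec_has_rank a b r \<longleftrightarrow> elliptic_curve a b \<and> has_rank (ec_group a b) r"

end

theory Submission
  imports Defs "HOL-Computational_Algebra.Squarefree"
begin

text \<open>
  Both families consist of primes \<open>p = 8 m\<^sup>2 - 5\<close> that are nonresidues modulo 5. A descent via the
  2-isogeny shows that \<open>E(\<rat>) / 2 E(\<rat>)\<close> is generated by the classes of the 2-torsion point
  \<open>T = (0, 0)\<close> and of \<open>P0 = (4 m\<^sup>2, 2 m (4 m\<^sup>2 - 5))\<close>; every other square class is excluded modulo
  4 or modulo 5. The naive height then makes \<open>E(\<rat>)\<close> finitely generated, and a finitely generated
  group \<open>M\<close> with \<open>M = 2 M + N\<close> satisfies \<open>d M \<subseteq> N\<close> for some odd \<open>d\<close>, so that the rank is at most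
  one. Since \<open>T\<close> is the only point of order 2 and none of \<open>T\<close>, \<open>P0\<close>, \<open>P0 + T\<close> is divisible by 2,
  \<open>P0\<close> has infinite order.
\<close>

section \<open>The group law\<close>

text \<open>The shape \<open>p = 8 m^2 - 5\<close> supplies the point P0: at
  \<open>x = 4 m^2\<close>, itself a square, the factor \<open>x^2 - 5 p\<close> becomes
  \<open>(4 m^2 - 5)^2\<close>. The two families are the classes 1 and 4 of \<open>m^2\<close>
  modulo 5, which give \<open>p\<close> the residues 3 and 2. The isogeny is never built as a map. A
  point \<open>(w^2, w v)\<close> carries the number \<open>2 (w^2 + v)\<close>, and divisibility by
  2 is read off from its class modulo squares. Local conditions leave four such classes; the choice
  of sign of \<open>w\<close> identifies them in pairs, and P0 realises the nontrivial pair. Hence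
  every P satisfies \<open>R + R = P + c\<close> for some R, with \<open>c\<close> among 0, T, P0, T
  + P0. This explicit statement is used twice: heights turn it into finite generation, and an
  elimination of generators relative to the points commensurable with P0 turns it into the bound on
  the rank, so that no index or Selmer group has to be computed.\<close>

text \<open>
  The slope \<open>m\<close> of the chord or tangent through two points. The first equation alone fails to
  determine \<open>m\<close> when the abscissae agree; the second, its conjugate, alone fails when the
  ordinates cancel. Together they cover chords and tangents without a case distinction.
\<close>

definition secant :: "'a::field \<Rightarrow> 'a \<Rightarrow> 'a \<Rightarrow> 'a \<Rightarrow> 'a \<Rightarrow> 'a \<Rightarrow> bool" where
  "secant a x1 y1 x2 y2 m \<longleftrightarrow> y2 - y1 = m * (x2 - x1) \<and> m * (y1 + y2) = x1\<^sup>2 + x1 * x2 + x2\<^sup>2 + a"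

definition ec_neg :: "'a::field point \<Rightarrow> 'a point" where
  "ec_neg P = (case P of Infinity \<Rightarrow> Infinity | Affine x y \<Rightarrow> Affine x (- y))"

lemma ec_neg_simps [simp]: "ec_neg Infinity = Infinity" "ec_neg (Affine x y) = Affine x (- y)"
  by (simp_all add: ec_neg_def)

lemma ec_add_Infinity_right [simp]: "ec_add a P Infinity = P"
  by (cases P) auto

lemma elliptic_curve_two_neq_0: "elliptic_curve a (b::'a::field) \<Longrightarrow> (2::'a) \<noteq> 0"
proof
  assume "elliptic_curve a b" and 2: "(2::'a) = 0"
  have "(16::'a) = 2 * 8" by simp
  with 2 have "(16::'a) = 0" by simp
  then show False using \<open>elliptic_curve a b\<close> by (simp add: elliptic_curve_def)
qed

lemma secant_commute: "secant a x1 y1 x2 y2 m \<longleftrightarrow> secant a x2 y2 x1 y1 m"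
  unfolding secant_def by (auto simp: algebra_simps)

lemma secant_unique:
  assumes "secant a x1 y1 x2 y2 m" "secant a x1 y1 x2 y2 m'" "\<not> (x1 = x2 \<and> y1 = - y2)"
  shows "m = m'"
proof (cases "x1 = x2")
  case True
  then have "y1 + y2 \<noteq> 0" using assms(3) by (metis add_eq_0_iff2)
  moreover have "m * (y1 + y2) = m' * (y1 + y2)"
    using assms unfolding secant_def by metis
  ultimately show ?thesis by simp
next
  case False
  have "m * (x2 - x1) = m' * (x2 - x1)"
    using assms unfolding secant_def by metis
  with False show ?thesis by simp
qed

lemma ec_add_secant_ex:
  assumes "(2::'a::field) \<noteq> 0" "on_curve a b (Affine x1 y1)" "on_curve a b (Affine x2 y2)"
    and "\<not> (x1 = x2 \<and> y1 = - (y2::'a))"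
  shows "\<exists>m. secant a x1 y1 x2 y2 m \<and>
    ec_add a (Affine x1 y1) (Affine x2 y2) = Affine (m\<^sup>2 - x1 - x2) (m * (x1 - (m\<^sup>2 - x1 - x2)) - y1)"
proof -
  define m where "m = (if x1 = x2 then (3 * x1\<^sup>2 + a) / (2 * y1) else (y2 - y1) / (x2 - x1))"
  have "secant a x1 y1 x2 y2 m"
  proof (cases "x1 = x2")
    case True
    then have "y1\<^sup>2 = y2\<^sup>2" using assms by simp
    with True assms(4) have "y1 = y2" by (metis power2_eq_iff)
    with assms(1,4) True have "2 * y1 \<noteq> 0" 
      by (metis add_eq_0_iff2 mult_2 mult_eq_0_iff)
    then have "m * (2 * y1) = 3 * x1\<^sup>2 + a"
      using True by (simp add: m_def)
    moreover have "y1 + y2 = 2 * y1" "x1\<^sup>2 + x1 * x2 + x2\<^sup>2 = 3 * x1\<^sup>2"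
      using True \<open>y1 = y2\<close> by (simp_all add: power2_eq_square)
    ultimately show ?thesis using True \<open>y1 = y2\<close> by (simp add: secant_def)
  next
    case False
    then have m: "m * (x2 - x1) = y2 - y1" by (simp add: m_def)
    have "y1\<^sup>2 = x1^3 + a * x1 + b" "y2\<^sup>2 = x2^3 + a * x2 + b" using assms by auto
    moreover have "(x2 - x1) * (m * (y1 + y2)) = y2\<^sup>2 - y1\<^sup>2"
      using m by algebra
    ultimately have "(x2 - x1) * (m * (y1 + y2)) = (x2 - x1) * (x1\<^sup>2 + x1 * x2 + x2\<^sup>2 + a)"
      by (simp add: algebra_simps power2_eq_square power3_eq_cube)
    with False m show ?thesis by (simp add: secant_def)
  qed
  then show ?thesis
    using assms(4) by (intro exI[of _ m]) (auto simp: m_def Let_def)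
qed

lemma ec_add_secant:
  assumes "(2::'a::field) \<noteq> 0" "on_curve a b (Affine x1 y1)" "on_curve a b (Affine x2 y2)"
    and "\<not> (x1 = x2 \<and> y1 = - (y2::'a))" "secant a x1 y1 x2 y2 m"
  shows "ec_add a (Affine x1 y1) (Affine x2 y2) = Affine (m\<^sup>2 - x1 - x2) (m * (x1 - (m\<^sup>2 - x1 - x2)) - y1)"
  using ec_add_secant_ex[OF assms(1-4)] secant_unique assms(4,5) by metis

lemma secant_third:
  assumes "on_curve a b (Affine x1 y1)" "secant a x1 y1 x2 y2 m"
    and "x3 = m\<^sup>2 - x1 - x2" "y3 = m * (x1 - x3) - y1"
  shows "on_curve a b (Affine x3 y3)" "secant a x1 (- y1) x3 y3 (- m)"
proof -
  have *: "y1\<^sup>2 = x1^3 + a * x1 + b" "y2 - y1 = m * (x2 - x1)"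
    "m * (y1 + y2) = x1\<^sup>2 + x1 * x2 + x2\<^sup>2 + a"
    using assms(1,2) by (auto simp: secant_def)
  have "y3\<^sup>2 = x3^3 + a * x3 + b" using * assms(3,4) by algebra
  then show "on_curve a b (Affine x3 y3)" by simp
  have "- m * (- y1 + y3) = x1\<^sup>2 + x1 * x3 + x3\<^sup>2 + a" using * assms(3,4) by algebra
  with assms(4) show "secant a x1 (- y1) x3 y3 (- m)"
    by (simp add: secant_def algebra_simps)
qed

lemma on_curve_neg [simp]: "on_curve a b (ec_neg P) \<longleftrightarrow> on_curve a b P"
  by (cases P) auto

lemma ec_add_neg_right [simp]: "ec_add a P (ec_neg P) = Infinity"
  by (cases P) auto

lemma ec_neg_neg [simp]: "ec_neg (ec_neg P) = P"
  by (cases P) auto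

lemma ec_add_eq_Infinity: "ec_add a P Q = Infinity \<Longrightarrow> Q = ec_neg P"
  by (cases P; cases Q) (auto simp: Let_def split: if_splits)

locale nonsingular_cubic =
  fixes a b :: "'a::field"
  assumes nonsingular: "elliptic_curve a b"
begin

lemma two_neq_0: "(2::'a) \<noteq> 0" using nonsingular by (rule elliptic_curve_two_neq_0)

lemma on_curve_add:
  assumes "on_curve a b P" "on_curve a b Q"
  shows "on_curve a b (ec_add a P Q)"
proof (cases "P = Infinity \<or> Q = Infinity \<or> Q = ec_neg P")
  case True then show ?thesis using assms by auto
next
  case False
  then obtain x1 y1 x2 y2 where [simp]: "P = Affine x1 y1" "Q = Affine x2 y2"
    by (meson point.exhaust)
  have "\<not> (x1 = x2 \<and> y1 = - y2)" using False by auto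
  from ec_add_secant_ex[OF two_neq_0 _ _ this] assms secant_third(1)
  show ?thesis by (metis \<open>P = Affine x1 y1\<close> \<open>Q = Affine x2 y2\<close>)
qed

lemma ec_add_commute:
  assumes "on_curve a b P" "on_curve a b Q"
  shows "ec_add a P Q = ec_add a Q P"
proof (cases "P = Infinity \<or> Q = Infinity \<or> Q = ec_neg P")
  case True then show ?thesis by (metis ec_add.simps(1) ec_add_Infinity_right ec_add_neg_right ec_neg_neg)
next
  case False
  then obtain x1 y1 x2 y2 where PQ: "P = Affine x1 y1" "Q = Affine x2 y2"
    by (meson point.exhaust)
  have n: "\<not> (x1 = x2 \<and> y1 = - y2)" "\<not> (x2 = x1 \<and> y2 = - y1)" using False PQ by auto
  from ec_add_secant_ex[OF two_neq_0 _ _ this(1)] obtain m where m: "secant a x1 y1 x2 y2 m"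
    using assms PQ by metis
  from ec_add_secant[OF two_neq_0 _ _ n(1) m] ec_add_secant[OF two_neq_0 _ _ n(2)] m
  have "ec_add a P Q = Affine (m\<^sup>2 - x1 - x2) (m * (x1 - (m\<^sup>2 - x1 - x2)) - y1)"
    "ec_add a Q P = Affine (m\<^sup>2 - x2 - x1) (m * (x2 - (m\<^sup>2 - x2 - x1)) - y2)"
    using assms PQ secant_commute by metis+
  moreover have "m * (x1 - (m\<^sup>2 - x1 - x2)) - y1 = m * (x2 - (m\<^sup>2 - x2 - x1)) - y2"
    using m unfolding secant_def by algebra
  ultimately show ?thesis by (simp add: algebra_simps)
qed

text \<open>The line through P and Q, reflected in the x-axis, passes through -P, -Q and P + Q, so
  adding -P to P + Q gives back Q. This cancellation is available before associativity and replaces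
  it in the degenerate cases there.\<close>

lemma ec_neg_add_cancel:
  assumes P: "on_curve a b P" and Q: "on_curve a b Q"
  shows "ec_add a (ec_neg P) (ec_add a P Q) = Q"
proof (cases "P = Infinity \<or> Q = Infinity \<or> Q = ec_neg P")
  case True then show ?thesis 
    by (metis ec_add.simps(1) ec_add_Infinity_right ec_add_neg_right ec_neg_neg ec_neg_simps(1))
next
  case False
  then obtain x1 y1 x2 y2 where PQ: "P = Affine x1 y1" "Q = Affine x2 y2"
    by (meson point.exhaust)
  have n: "\<not> (x1 = x2 \<and> y1 = - y2)" using False PQ by auto
  from ec_add_secant_ex[OF two_neq_0 _ _ this] obtain m where m: "secant a x1 y1 x2 y2 m"
    using assms PQ by metis
  define x3 where "x3 = m\<^sup>2 - x1 - x2"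
  define y3 where "y3 = m * (x1 - x3) - y1"
  have S: "ec_add a P Q = Affine x3 y3"
    using ec_add_secant[OF two_neq_0 _ _ n m] assms PQ unfolding x3_def y3_def by metis
  note t = secant_third[OF P[unfolded PQ] m x3_def y3_def]
  have *: "y1\<^sup>2 = x1^3 + a * x1 + b" "y2 - y1 = m * (x2 - x1)"
    "- m * (- y1 + y3) = x1\<^sup>2 + x1 * x3 + x3\<^sup>2 + a"
    using P PQ m t(2) by (auto simp: secant_def)
  \<comment> \<open>The remaining exception is \<open>P + Q = P\<close> with Q affine. It would make
    P a singular point, with \<open>y1 = 0\<close> and \<open>3 x1^2 + a = 0\<close>.\<close>
  have "\<not> (x1 = x3 \<and> - y1 = - y3)"
  proof
    assume e: "x1 = x3 \<and> - y1 = - y3"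
    then have "2 * y1 = 0" using y3_def by simp
    then have "y1 = 0" using two_neq_0 by simp
    with e * have "3 * x1\<^sup>2 + a = 0" by (simp add: power2_eq_square)
    with * \<open>y1 = 0\<close> have "4 * a ^ 3 + 27 * b\<^sup>2 = 0" by algebra
    with nonsingular show False by (simp add: elliptic_curve_def)
  qed
  from ec_add_secant[OF two_neq_0 _ t(1) this t(2)] P PQ
  have "ec_add a (Affine x1 (- y1)) (Affine x3 y3) =
    Affine ((- m)\<^sup>2 - x1 - x3) ((- m) * (x1 - ((- m)\<^sup>2 - x1 - x3)) - - y1)" by simp
  moreover have "(- m)\<^sup>2 - x1 - x3 = x2" by (simp add: x3_def)
  moreover have "(- m) * (x1 - x2) - - y1 = y2" using * by algebra
  ultimately show ?thesis unfolding S unfolding PQ ec_neg_simps by (simp only:)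
qed

lemma ec_neg_add:
  assumes P: "on_curve a b P" and Q: "on_curve a b Q"
  shows "ec_neg (ec_add a P Q) = ec_add a (ec_neg P) (ec_neg Q)"
proof (cases "P = Infinity \<or> Q = Infinity \<or> Q = ec_neg P")
  case True then show ?thesis
    by (metis ec_add.simps(1) ec_add_Infinity_right ec_add_neg_right ec_neg_simps(1))
next
  case False
  then obtain x1 y1 x2 y2 where PQ: "P = Affine x1 y1" "Q = Affine x2 y2"
    by (meson point.exhaust)
  have n: "\<not> (x1 = x2 \<and> y1 = - y2)" "\<not> (x1 = x2 \<and> - y1 = - (- y2))" using False PQ by auto
  from ec_add_secant_ex[OF two_neq_0 _ _ this(1)] obtain m where m: "secant a x1 y1 x2 y2 m"
    using assms PQ by metis
  then have m': "secant a x1 (- y1) x2 (- y2) (- m)"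
    by (simp add: secant_def algebra_simps)
  have "ec_add a P Q = Affine (m\<^sup>2 - x1 - x2) (m * (x1 - (m\<^sup>2 - x1 - x2)) - y1)"
    using ec_add_secant[OF two_neq_0 _ _ n(1) m] assms PQ by metis
  moreover have "ec_add a (ec_neg P) (ec_neg Q) 
      = Affine ((- m)\<^sup>2 - x1 - x2) ((- m) * (x1 - ((- m)\<^sup>2 - x1 - x2)) - - y1)"
    using ec_add_secant[OF two_neq_0 _ _ n(2) m'] assms PQ by simp
  ultimately show ?thesis by (simp add: algebra_simps)
qed

end

section \<open>Associativity of the addition\<close>

text \<open>With Q moved to the origin, \<open>u\<close> and \<open>v\<close> are the abscissae of P
  and R, and \<open>l\<close> and \<open>mu\<close> the slopes towards them. Once the two slope sums
  agree, associativity needs no curve equation: substituting for \<open>v\<close> and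
  \<open>s\<close> leaves polynomial identities in \<open>u\<close>, \<open>l\<close>,
  \<open>mu\<close>, \<open>t\<close>.\<close>

lemma secant_assoc_aux:
  fixes u v l mu s t :: "'a::field"
  assumes "(l + s) * (mu - l) = v - u" "l + s = mu + t"
  shows "s\<^sup>2 - l\<^sup>2 + u - v = t\<^sup>2 - mu\<^sup>2 + v - u"
    and "s * (v - (s\<^sup>2 - l\<^sup>2 + u - v)) - mu * v = t * (u - (t\<^sup>2 - mu\<^sup>2 + v - u)) - l * u"
proof -
  have "v = u + (mu + t) * (mu - l)" "s = mu + t - l" using assms by (simp_all add: algebra_simps)
  then show "s\<^sup>2 - l\<^sup>2 + u - v = t\<^sup>2 - mu\<^sup>2 + v - u"
    and "s * (v - (s\<^sup>2 - l\<^sup>2 + u - v)) - mu * v = t * (u - (t\<^sup>2 - mu\<^sup>2 + v - u)) - l * u"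
    by (simp_all only:) (simp_all add: algebra_simps power2_eq_square)
qed

text \<open>
  Both sides of the associative law come from the conic \<open>x\<^sup>2 + \<beta> x + \<gamma> - \<rho> y\<close> through
  \<open>P, Q, R\<close>, where \<open>\<rho>\<close> is the sum of the two slopes used on either side. The identity below
  determines \<open>\<rho>\<close> by \<open>\<rho> (mu - l) = x3 - x1\<close>, which is symmetric in \<open>P\<close> and \<open>R\<close>.
\<close>

lemma secant_slope_sum:
  assumes 12: "secant a x1 y1 x2 y2 l" and 23: "secant a x2 y2 x3 y3 mu"
    and xs: "xs = l\<^sup>2 - x1 - x2" and ys: "ys = l * (x1 - xs) - y1"
    and s: "secant a xs ys x3 y3 s" 
    and n: "xs = x3 \<Longrightarrow> x2 = x3 \<Longrightarrow> y2 = y3 \<Longrightarrow> 2 * y2 \<noteq> 0"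
    and nn: "xs = x3 \<Longrightarrow> ys = y3"
  shows "(l + s) * (mu - l) = x3 - x1"
proof (cases "xs = x3")
  case False
  have "(xs - x3) * ((l + s) * (mu - l)) = (xs - x3) * (x3 - x1)"
    using 12 23 s xs ys unfolding secant_def by algebra
  then show ?thesis using False by simp
next
  case True
  show ?thesis
  proof (cases "x2 = x3")
    case False
    have "(x3 - x2) * ((l + s) * (mu - l)) = (x3 - x2) * (x3 - x1)"
      using 12 23 s xs ys True nn[OF True] unfolding secant_def by algebra
    then show ?thesis using False by simp
  next
    case True': True
    have "y2 = y3" using True' 23 by (simp add: secant_def)
    have "2 * y2 = 0"
      using 12 23 s xs ys True True' nn[OF True] \<open>y2 = y3\<close> unfolding secant_def by algebra
    then show ?thesis using n True True' \<open>y2 = y3\<close> by simp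
  qed
qed

context nonsingular_cubic
begin

text \<open>\<open>secant_slope_sum\<close> for (P, Q, R) and for (R, Q, P) gives both slope sums
  the same product with \<open>mu - l\<close>. Cancelling this factor is where P = R must be
  excluded; in that case commutativity alone gives associativity.\<close>

lemma secant_assoc:
  assumes curve: "on_curve a b (Affine x1 y1)" "on_curve a b (Affine x2 y2)" "on_curve a b (Affine x3 y3)"
    and 12: "secant a x1 y1 x2 y2 l" and 23: "secant a x2 y2 x3 y3 mu"
    and xs: "xs = l\<^sup>2 - x1 - x2" and ys: "ys = l * (x1 - xs) - y1"
    and xu: "xu = mu\<^sup>2 - x2 - x3" and yu: "yu = mu * (x2 - xu) - y2"
    and s: "secant a xs ys x3 y3 s" and t: "secant a x1 y1 xu yu t"
    and n12: "\<not> (x1 = x2 \<and> y1 = - y2)" and n23: "\<not> (x2 = x3 \<and> y2 = - y3)"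
    and ns: "\<not> (xs = x3 \<and> ys = - y3)" and nt: "\<not> (x1 = xu \<and> y1 = - yu)"
    and ne: "\<not> (x1 = x3 \<and> y1 = y3)"
  shows "s\<^sup>2 - xs - x3 = t\<^sup>2 - x1 - xu"
    "s * (x3 - (s\<^sup>2 - xs - x3)) - y3 = t * (x1 - (t\<^sup>2 - x1 - xu)) - y1"
proof -
  have c: "on_curve a b (Affine xs ys)" "on_curve a b (Affine xu yu)"
    using secant_third(1)[OF curve(1) 12 xs ys] secant_third(1)[OF curve(2) 23 xu yu] .
  have eq: "y = y'" if "on_curve a b (Affine x y)" "on_curve a b (Affine x y')" "y \<noteq> - y'" for x y y'
    using that by (metis on_curve.simps(2) power2_eq_iff)
  have yu': "yu = mu * (x3 - xu) - y3" using 23 yu unfolding secant_def by algebra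
  have L: "(l + s) * (mu - l) = x3 - x1"
  proof (rule secant_slope_sum[OF 12 23 xs ys s])
    show "2 * y2 \<noteq> 0" if "x2 = x3" "y2 = y3" using n23 two_neq_0 that
      by (metis add_eq_0_iff2 mult_2)
    show "ys = y3" if "xs = x3" using ns eq c curve that by blast
  qed
  have M: "(mu + t) * (l - mu) = x1 - x3"
  proof (rule secant_slope_sum[of a x3 y3 x2 y2 _ x1 y1])
    show "secant a x3 y3 x2 y2 mu" "secant a x2 y2 x1 y1 l" "secant a xu yu x1 y1 t"
      using 12 23 t secant_commute by metis+
    show "xu = mu\<^sup>2 - x3 - x2" "yu = mu * (x3 - xu) - y3" using xu yu' by auto
    show "2 * y2 \<noteq> 0" if "x2 = x1" "y2 = y1" using n12 two_neq_0 that
      by (metis add_eq_0_iff2 mult_2)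
    show "yu = y1" if "xu = x1" using nt eq c curve that by metis
  qed
  have "mu \<noteq> l"
  proof
    assume "mu = l"
    with L have "x1 = x3" by simp
    with 12 23 \<open>mu = l\<close> have "y1 = y3" unfolding secant_def by algebra
    with ne \<open>x1 = x3\<close> show False by simp
  qed
  have "(l + s) * (mu - l) = (mu + t) * (mu - l)" using L M by algebra
  with \<open>mu \<noteq> l\<close> have *: "l + s = mu + t" by simp
  have **: "(l + s) * (mu - l) = (x3 - x2) - (x1 - x2)" using L by simp
  have y: "y1 - y2 = l * (x1 - x2)" "y3 - y2 = mu * (x3 - x2)"
    using 12 23 unfolding secant_def by algebra+
  have X: "s\<^sup>2 - xs - x3 = x2 + (s\<^sup>2 - l\<^sup>2 + (x1 - x2) - (x3 - x2))"
     "t\<^sup>2 - x1 - xu = x2 + (t\<^sup>2 - mu\<^sup>2 + (x3 - x2) - (x1 - x2))"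
    unfolding xs xu by (simp_all add: algebra_simps)
  show "s\<^sup>2 - xs - x3 = t\<^sup>2 - x1 - xu"
    using secant_assoc_aux(1)[OF ** *] unfolding X by simp
  have Y: "s * (x3 - (s\<^sup>2 - xs - x3)) - y3 
      = s * (x3 - x2 - (s\<^sup>2 - l\<^sup>2 + (x1 - x2) - (x3 - x2))) - mu * (x3 - x2) - y2"
    unfolding X using y by (simp add: algebra_simps)
  have Y': "t * (x1 - (t\<^sup>2 - x1 - xu)) - y1
      = t * (x1 - x2 - (t\<^sup>2 - mu\<^sup>2 + (x3 - x2) - (x1 - x2))) - l * (x1 - x2) - y2"
    unfolding X using y by (simp add: algebra_simps)
  show "s * (x3 - (s\<^sup>2 - xs - x3)) - y3 = t * (x1 - (t\<^sup>2 - x1 - xu)) - y1"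
    using secant_assoc_aux(2)[OF ** *] unfolding Y Y' by simp
qed

text \<open>Whenever one of the sums degenerates, commutativity, cancellation and compatibility with
  negation settle the claim. The cases are listed so that the last one meets every side condition of
  \<open>secant_assoc\<close>.\<close>

lemma ec_add_assoc:
  assumes P: "on_curve a b P" and Q: "on_curve a b Q" and R: "on_curve a b R"
  shows "ec_add a (ec_add a P Q) R = ec_add a P (ec_add a Q R)"
proof -
  note comm = ec_add_commute and cl = on_curve_add on_curve_neg
  have can: "ec_add a (ec_neg P) (ec_add a P Q) = Q" "ec_add a P (ec_add a (ec_neg P) Q) = Q"
      if "on_curve a b P" "on_curve a b Q" for P Q
    using that ec_neg_add_cancel[of P Q] ec_neg_add_cancel[of "ec_neg P" Q] by auto
  consider "P = Infinity" | "Q = Infinity" | "R = Infinity" | "Q = ec_neg P" | "R = ec_neg Q"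
    | "R = ec_neg (ec_add a P Q)" | "ec_add a Q R = ec_neg P" | "P = R"
    | "P \<noteq> Infinity" "Q \<noteq> Infinity" "R \<noteq> Infinity" "Q \<noteq> ec_neg P" "R \<noteq> ec_neg Q"
      "R \<noteq> ec_neg (ec_add a P Q)" "ec_add a Q R \<noteq> ec_neg P" "P \<noteq> R" by blast
  then show ?thesis
  proof cases
    case 4
    then show ?thesis using can(2)[OF P R] by simp
  next
    case 5
    have "ec_add a (ec_add a P Q) (ec_neg Q) = P"
      using can(1)[OF Q P] P Q comm cl by metis
    with 5 show ?thesis by simp
  next
    case 6
    then have "R = ec_add a (ec_neg Q) (ec_neg P)" using ec_neg_add P Q comm cl by metis
    then have "ec_add a Q R = ec_neg P" using can(2)[OF Q, of "ec_neg P"] P by simp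
    with 6 show ?thesis by simp
  next
    case 7
    then have "P = ec_add a (ec_neg R) (ec_neg Q)" 
      using ec_neg_add Q R comm cl ec_neg_neg by metis
    then have "ec_add a R P = ec_neg Q" using can(2)[OF R, of "ec_neg Q"] Q by simp
    then have "P = ec_add a (ec_neg R) (ec_neg Q)" using can(1)[OF R P] by simp
    then have "ec_add a P Q = ec_neg R" 
      using can(2)[of Q "ec_neg R"] Q R comm cl by metis
    with 7 show ?thesis
      using R ec_add_commute ec_add_neg_right on_curve_neg by metis
  next
    case 8
    then show ?thesis using P Q comm cl by metis
  next
    case 9
    then obtain x1 y1 x2 y2 x3 y3 where A: "P = Affine x1 y1" "Q = Affine x2 y2" "R = Affine x3 y3"
      by (meson point.exhaust)
    note c = P[unfolded A] Q[unfolded A] R[unfolded A]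
    have n12: "\<not> (x1 = x2 \<and> y1 = - y2)" and n23: "\<not> (x2 = x3 \<and> y2 = - y3)"
      and ne: "\<not> (x1 = x3 \<and> y1 = y3)" using 9 A by auto
    obtain l where l: "secant a x1 y1 x2 y2 l" using ec_add_secant_ex[OF two_neq_0 c(1,2) n12] by blast
    obtain mu where mu: "secant a x2 y2 x3 y3 mu" using ec_add_secant_ex[OF two_neq_0 c(2,3) n23] by blast
    define xs ys xu yu where xs: "xs = l\<^sup>2 - x1 - x2" and ys: "ys = l * (x1 - xs) - y1"
      and xu: "xu = mu\<^sup>2 - x2 - x3" and yu: "yu = mu * (x2 - xu) - y2"
    have PQ: "ec_add a P Q = Affine xs ys"
      unfolding A ys xs by (rule ec_add_secant[OF two_neq_0 c(1,2) n12 l])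
    have QR: "ec_add a Q R = Affine xu yu"
      unfolding A yu xu by (rule ec_add_secant[OF two_neq_0 c(2,3) n23 mu])
    have cs: "on_curve a b (Affine xs ys)" "on_curve a b (Affine xu yu)"
      using on_curve_add P Q R PQ QR by metis+
    have ns: "\<not> (x3 = xs \<and> y3 = - ys)" "\<not> (xs = x3 \<and> ys = - y3)" 
      and nt: "\<not> (x1 = xu \<and> y1 = - yu)"
      using 9 A unfolding PQ QR by auto
    obtain s where s: "secant a xs ys x3 y3 s" using ec_add_secant_ex[OF two_neq_0 cs(1) c(3) ns(2)] by blast
    obtain t where t: "secant a x1 y1 xu yu t" using ec_add_secant_ex[OF two_neq_0 c(1) cs(2) nt] by blast
    have "ec_add a (ec_add a P Q) R = ec_add a R (ec_add a P Q)"
      using comm cl P Q R by blast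
    also have "\<dots> = Affine (s\<^sup>2 - x3 - xs) (s * (x3 - (s\<^sup>2 - x3 - xs)) - y3)"
      unfolding PQ unfolding A using s secant_commute
      by (intro ec_add_secant[OF two_neq_0 c(3) cs(1) ns(1)]) blast
    also have "\<dots> = Affine (s\<^sup>2 - xs - x3) (s * (x3 - (s\<^sup>2 - xs - x3)) - y3)"
      by (simp add: algebra_simps)
    also have "\<dots> = Affine (t\<^sup>2 - x1 - xu) (t * (x1 - (t\<^sup>2 - x1 - xu)) - y1)"
      using secant_assoc[OF c l mu xs ys xu yu s t n12 n23 ns(2) nt ne] by simp
    also have "\<dots> = ec_add a P (ec_add a Q R)"
      unfolding QR unfolding A by (rule ec_add_secant[OF two_neq_0 c(1) cs(2) nt t, symmetric])
    finally show ?thesis .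
  qed auto
qed

lemma comm_group_ec: "comm_group (ec_group a b)"
proof (rule comm_groupI)
  fix P assume "P \<in> carrier (ec_group a b)"
  then show "\<exists>Q\<in>carrier (ec_group a b). Q \<otimes>\<^bsub>ec_group a b\<^esub> P = \<one>\<^bsub>ec_group a b\<^esub>"
    using ec_add_neg_right[of a "ec_neg P"]
    by (intro bexI[of _ "ec_neg P"]) (auto simp: ec_group_def)
qed (auto simp: ec_group_def intro: on_curve_add ec_add_commute ec_add_assoc)

end

section \<open>Finitely generated abelian groups of rank one\<close>

text \<open>Halving modulo \<open>C\<close> strictly lowers \<open>h\<close> as long as it exceeds
  \<open>B\<close>, so the process ends among the finitely many elements with
  \<open>h x \<le> B\<close>; these generate together with \<open>C\<close>.\<close>

lemma (in group) finitely_generated_by_descent: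
  fixes h :: "'a \<Rightarrow> nat"
  assumes C: "finite C" "C \<subseteq> carrier G" and fin: "finite {x \<in> carrier G. h x \<le> B}"
    and desc: "\<And>x. x \<in> carrier G \<Longrightarrow> B < h x \<Longrightarrow>
      \<exists>r\<in>carrier G. \<exists>c\<in>C. x = (r \<otimes> r) \<otimes> c \<and> h r < h x"
  shows "finitely_generated_group G"
proof -
  define S where "S = C \<union> {x \<in> carrier G. h x \<le> B}"
  have S: "finite S" "S \<subseteq> carrier G" using C fin by (auto simp: S_def)
  have "x \<in> generate G S" if "x \<in> carrier G" for x
    using that
  proof (induction "h x" arbitrary: x rule: less_induct)
    case less
    show ?case
    proof (cases "h x \<le> B")
      case True
      then show ?thesis using less.prems by (intro generate.incl) (auto simp: S_def)
    next
      case False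
      then obtain r c where r: "r \<in> carrier G" "c \<in> C" "x = (r \<otimes> r) \<otimes> c" "h r < h x"
        using desc[OF less.prems] by force
      then have "r \<in> generate G S" "c \<in> generate G S"
        using less.hyps by (auto simp: S_def intro: generate.incl)
      then show ?thesis unfolding r(3) by (intro generate.eng)
    qed
  qed
  then have "generate G S = carrier G" using generate_incl[OF S(2)] by blast
  with S show ?thesis unfolding finitely_generated_group_def by blast
qed

context comm_group
begin

lemma subgroup_cyclic_extension:
  assumes K: "subgroup K G" and s: "s \<in> carrier G"
  shows "subgroup {s [^] i \<otimes> k | (i::int) k. k \<in> K} G"
proof (rule subgroupI)
  have c: "\<And>k. k \<in> K \<Longrightarrow> k \<in> carrier G" using K subgroup.mem_carrier by metis
  show "{s [^] i \<otimes> k | (i::int) k. k \<in> K} \<subseteq> carrier G" using s c by auto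
  show "{s [^] i \<otimes> k | (i::int) k. k \<in> K} \<noteq> {}" using subgroup.one_closed[OF K] by auto
  fix a assume "a \<in> {s [^] i \<otimes> k | (i::int) k. k \<in> K}"
  then obtain i :: int and k where a: "a = s [^] i \<otimes> k" "k \<in> K" by auto
  have "inv a = s [^] (- i) \<otimes> inv k"
    using a s c by (simp add: inv_mult int_pow_neg)
  then show "inv a \<in> {s [^] i \<otimes> k | (i::int) k. k \<in> K}"
    using subgroup.m_inv_closed[OF K a(2)] by blast
  fix b assume "b \<in> {s [^] i \<otimes> k | (i::int) k. k \<in> K}"
  then obtain j :: int and l where b: "b = s [^] j \<otimes> l" "l \<in> K" by auto
  have "a \<otimes> b = s [^] (i + j) \<otimes> (k \<otimes> l)"
    using a b s c by (simp add: int_pow_mult m_ac)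
  then show "a \<otimes> b \<in> {s [^] i \<otimes> k | (i::int) k. k \<in> K}"
    using subgroup.m_closed[OF K a(2) b(2)] by blast
qed

text \<open>
  A module \<open>M\<close> with \<open>M = 2M\<close> on finitely many generators is killed by an odd number; this is the
  same statement relative to a subgroup \<open>N\<close>. The generators are eliminated one at a time:
  \<open>s = 2(j s + k) + n\<close> puts \<open>(1 - 2j) s\<close> into the span of the others.
\<close>

lemma odd_power_into_subgroup:
  assumes N: "subgroup N G" and S: "finite S" "S \<subseteq> carrier G"
    and "subgroup K G" "N \<subseteq> K" "K \<subseteq> generate G (N \<union> S)" "S \<subseteq> K"
    and "\<And>x. x \<in> K \<Longrightarrow> \<exists>y\<in>K. \<exists>n\<in>N. x = (y \<otimes> y) \<otimes> n"
  shows "\<exists>d::int. odd d \<and> (\<forall>x\<in>K. x [^] d \<in> N)"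
  using S assms(4-)
proof (induction S arbitrary: K rule: finite_induct)
  case empty
  have "x [^] (1::int) \<in> N" if "x \<in> K" for x
  proof -
    have "x \<in> N" using empty that generate_subgroup_incl[OF _ N, of N] by auto
    then show ?thesis using subgroup.mem_carrier[OF N] by simp
  qed
  then show ?case by (intro exI[of _ 1]) auto
next
  case (insert s S)
  define K' where "K' = generate G (N \<union> S)"
  have Nc: "N \<subseteq> carrier G" using N subgroup.subset by blast
  have s: "s \<in> carrier G" and Sc: "S \<subseteq> carrier G" using insert by auto
  have K': "subgroup K' G" unfolding K'_def using Nc Sc by (intro generate_is_subgroup) auto
  have K'c: "\<And>k. k \<in> K' \<Longrightarrow> k \<in> carrier G" using K' subgroup.mem_carrier by metis
  have N': "N \<subseteq> K'" "S \<subseteq> K'" unfolding K'_def by (auto intro: generate.incl)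
  have "generate G (N \<union> insert s S) \<subseteq> {s [^] i \<otimes> k | (i::int) k. k \<in> K'}"
  proof (rule generate_subgroup_incl[OF _ subgroup_cyclic_extension[OF K' s]])
    have "s = s [^] (1::int) \<otimes> \<one>" using s by simp
    moreover have "x = s [^] (0::int) \<otimes> x" if "x \<in> K'" for x using K'c[OF that] by simp
    ultimately show "N \<union> insert s S \<subseteq> {s [^] i \<otimes> k | (i::int) k. k \<in> K'}"
      using N' subgroup.one_closed[OF K'] by blast
  qed
  then have dec: "\<exists>(i::int) k. k \<in> K' \<and> x = s [^] i \<otimes> k" if "x \<in> K" for x
    using insert.prems that by blast
  obtain y n where y: "y \<in> K" "n \<in> N" "s = (y \<otimes> y) \<otimes> n"
    using insert.prems by (meson insert_subset)
  obtain j :: int and k where k: "k \<in> K'" "y = s [^] j \<otimes> k" using dec[OF y(1)] by blast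
  define c where "c = 1 - 2 * j"
  have nc: "n \<in> carrier G" using y Nc by auto
  have "s [^] c \<in> K'"
  proof -
    have "s = (s [^] j \<otimes> k) \<otimes> (s [^] j \<otimes> k) \<otimes> n"
      unfolding k(2)[symmetric] by (fact y(3))
    also have "\<dots> = (s [^] j \<otimes> s [^] j) \<otimes> (k \<otimes> k \<otimes> n)"
      using s K'c[OF k(1)] nc by (simp add: m_ac)
    also have "s [^] j \<otimes> s [^] j = s [^] (2 * j)"
      using int_pow_mult[OF s, of j j] by simp
    finally have "s [^] (- (2 * j)) \<otimes> s = s [^] (- (2 * j)) \<otimes> (s [^] (2 * j) \<otimes> (k \<otimes> k \<otimes> n))" by simp
    also have "\<dots> = s [^] (- (2 * j) + 2 * j) \<otimes> (k \<otimes> k \<otimes> n)"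
      using s K'c[OF k(1)] nc by (subst int_pow_mult) (auto simp: m_assoc)
    also have "\<dots> = k \<otimes> k \<otimes> n" using K'c[OF k(1)] nc by simp
    also have "s [^] (- (2 * j)) \<otimes> s = s [^] (- (2 * j)) \<otimes> s [^] (1::int)" using s by simp
    also have "\<dots> = s [^] c" using s unfolding c_def by (subst int_pow_mult[symmetric]) auto
    finally have "s [^] c = k \<otimes> k \<otimes> n" .
    then show ?thesis using k y N' subgroup.m_closed[OF K'] by (metis subsetD)
  qed
  have int_pow_K': "x [^] (i::int) \<in> K'" if "x \<in> K'" for x i
    using that by (simp add: K' subgroup_int_pow_closed)
  have int_pow_N: "x [^] (i::int) \<in> N" if "x \<in> N" for x i
    using that by (simp add: N subgroup_int_pow_closed)
  have cK: "x [^] c \<in> K'" if x: "x \<in> K" for x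
  proof -
    obtain i :: int and l where l: "l \<in> K'" "x = s [^] i \<otimes> l" using dec[OF x] by blast
    have "x [^] c = (s [^] c) [^] i \<otimes> l [^] c"
      using l s K'c by (simp add: int_pow_distrib int_pow_pow mult.commute)
    then show ?thesis 
      using int_pow_K' l(1) \<open>s [^] c \<in> K'\<close> subgroup.m_closed[OF K'] by metis
  qed
  \<comment> \<open>The smaller subgroup inherits the hypothesis. Additively,
    \<open>x = c x + 2 j x\<close>; inserting \<open>x = 2 y + n\<close> into the first summand
    gives \<open>x = 2 (c y + j x) + c n\<close>, and \<open>c y\<close> lies in \<open>K'\<close>
    even if \<open>y\<close> does not.\<close>
  have "\<exists>y\<in>K'. \<exists>n\<in>N. x = (y \<otimes> y) \<otimes> n" if x: "x \<in> K'" for x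
  proof -
    have "K' \<subseteq> K" unfolding K'_def
      using insert.prems(3,5) by (intro generate_subgroup_incl[OF _ insert.prems(2)]) blast
    then obtain y n where y: "y \<in> K" "n \<in> N" "x = (y \<otimes> y) \<otimes> n" using insert.prems(6) x by blast
    have car: "y \<in> carrier G" "n \<in> carrier G" "x \<in> carrier G"
      using y(1,2) Nc K'c[OF x] subgroup.mem_carrier[OF insert.prems(2)] by auto
    have "x = x [^] c \<otimes> (x [^] j \<otimes> x [^] j)"
      using car by (simp add: c_def flip: int_pow_mult)
    also have "x [^] c = y [^] c \<otimes> y [^] c \<otimes> n [^] c"
      unfolding y(3) using car by (simp add: int_pow_distrib)
    also have "\<dots> \<otimes> (x [^] j \<otimes> x [^] j) = ((y [^] c \<otimes> x [^] j) \<otimes> (y [^] c \<otimes> x [^] j)) \<otimes> n [^] c"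
      using car by (simp add: m_ac)
    finally show ?thesis
      using int_pow_N[OF y(2)] cK[OF y(1)] int_pow_K'[OF x] subgroup.m_closed[OF K'] by blast
  qed
  then obtain d :: int where d: "odd d" "\<And>x. x \<in> K' \<Longrightarrow> x [^] d \<in> N"
    using insert.IH[OF Sc K' N'(1) _ N'(2)] K'_def by blast
  have "x [^] (c * d) \<in> N" if "x \<in> K" for x
    using d(2)[OF cK[OF that]] subgroup.mem_carrier[OF insert.prems(2) that] by (simp add: int_pow_pow)
  moreover have "odd (c * d)" using d by (simp add: c_def)
  ultimately show ?case by blast
qed

text \<open>The exponent \<open>i = 0\<close> puts all torsion into this subgroup. It will be the
  \<open>N\<close> of \<open>odd_power_into_subgroup\<close>: an element with a nonzero multiple in
  it is itself commensurable with \<open>P\<close>.\<close>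

lemma subgroup_commensurable:
  assumes P: "P \<in> carrier G"
  shows "subgroup {x \<in> carrier G. \<exists>n::nat. n > 0 \<and> (\<exists>i::int. x [^] n = P [^] i)} G"
proof (rule subgroupI)
  show "{x \<in> carrier G. \<exists>n::nat. n > 0 \<and> (\<exists>i::int. x [^] n = P [^] i)} \<noteq> {}"
    by (intro ex_in_conv[THEN iffD1] exI[of _ \<one>]) (auto intro!: exI[of _ "1::nat"] exI[of _ "0::int"])
next
  fix x assume "x \<in> {x \<in> carrier G. \<exists>n::nat. n > 0 \<and> (\<exists>i::int. x [^] n = P [^] i)}"
  then obtain n :: nat and i :: int where x: "x \<in> carrier G" "n > 0" "x [^] n = P [^] i" by auto
  have "inv x [^] n = P [^] (- i)"
    using x P by (simp add: nat_pow_inv int_pow_neg)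
  with x show "inv x \<in> {x \<in> carrier G. \<exists>n::nat. n > 0 \<and> (\<exists>i::int. x [^] n = P [^] i)}" by auto
  fix y assume "y \<in> {x \<in> carrier G. \<exists>n::nat. n > 0 \<and> (\<exists>i::int. x [^] n = P [^] i)}"
  then obtain m :: nat and j :: int where y: "y \<in> carrier G" "m > 0" "y [^] m = P [^] j" by auto
  have "(x \<otimes> y) [^] (n * m) = (x [^] n) [^] m \<otimes> (y [^] m) [^] n"
    using x(1) y(1) by (simp add: nat_pow_distrib nat_pow_pow mult.commute)
  also have "\<dots> = (P [^] i) [^] (int m) \<otimes> (P [^] j) [^] (int n)" using x y by (simp add: int_pow_int)
  also have "\<dots> = P [^] (i * int m + j * int n)" using P by (simp add: int_pow_pow int_pow_mult)
  finally show "x \<otimes> y \<in> {x \<in> carrier G. \<exists>n::nat. n > 0 \<and> (\<exists>i::int. x [^] n = P [^] i)}"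
    using x y by (auto intro!: exI[of _ "n * m"])
qed auto


text \<open>Take the least \<open>n\<close> with n P = 0, written additively. If \<open>n\<close> is
  odd, P is the double of ((n + 1) / 2) P. If \<open>n = 2 k\<close>, then k P has order two and
  equals T; for even \<open>k\<close> this makes T a double, for odd \<open>k\<close> it makes P + T
  = (k + 1) P one.\<close>

lemma infinite_order_of_non_doubles:
  assumes P: "P \<in> carrier G" and T: "T \<in> carrier G"
    and two: "\<And>x. x \<in> carrier G \<Longrightarrow> x \<otimes> x = \<one> \<Longrightarrow> x = \<one> \<or> x = T"
    and nsq: "\<And>x. x \<in> carrier G \<Longrightarrow> x \<otimes> x \<noteq> P" "\<And>x. x \<in> carrier G \<Longrightarrow> x \<otimes> x \<noteq> T"
      "\<And>x. x \<in> carrier G \<Longrightarrow> x \<otimes> x \<noteq> P \<otimes> T"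
  shows "n > 0 \<Longrightarrow> P [^] (n::nat) \<noteq> \<one>"
proof (induction n rule: less_induct)
  case (less n)
  have dbl: "P [^] k \<otimes> P [^] k = P [^] (2 * k)" for k :: nat
    using P by (simp add: nat_pow_mult mult_2)
  show ?case
  proof
    assume 1: "P [^] n = \<one>"
    show False
    proof (cases "even n")
      case False
      then obtain k where "n = 2 * k + 1" by (elim oddE)
      then have "P [^] (2 * (k + 1)) = P" using 1 P nat_pow_mult[of P n 1] by simp
      with dbl[of "k + 1"] nsq(1) P show False by (metis nat_pow_closed)
    next
      case True
      then obtain k where k: "n = 2 * k" by auto
      with less.prems less.IH[of k] have "P [^] k \<noteq> \<one>" by simp
      moreover have "P [^] k \<otimes> P [^] k = \<one>" using dbl k 1 by simp
      ultimately have PT: "P [^] k = T" using two P by (metis nat_pow_closed)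
      show False
      proof (cases "even k")
        case True
        then obtain j where "k = 2 * j" by auto
        with PT dbl[of j] nsq(2) P show False by (metis nat_pow_closed)
      next
        case False
        then obtain j where "k = 2 * j + 1" by (elim oddE)
        then have "P [^] (2 * (j + 1)) = P \<otimes> T" using PT P nat_pow_mult[of P k 1] m_comm T by simp
        with dbl[of "j + 1"] nsq(3) P show False by (metis nat_pow_closed)
      qed
    qed
  qed
qed

lemma int_pow_eq_iff_of_infinite_order:
  assumes P: "P \<in> carrier G" and inf: "\<And>n::nat. n > 0 \<Longrightarrow> P [^] n \<noteq> \<one>"
  shows "P [^] (i::int) = P [^] j \<longleftrightarrow> i = j"
proof
  assume "P [^] i = P [^] j"
  have *: False if "P [^] i = P [^] j" "i < j" for i j :: int
  proof -
    have "P [^] (j - i) = \<one>" using that P int_pow_diff[OF P, of j i] by simp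
    moreover have "int (nat (j - i)) = j - i" using that(2) by simp
    ultimately have "P [^] nat (j - i) = \<one>" using int_pow_int[of G P "nat (j - i)"] by metis
    moreover have "nat (j - i) > 0" using that(2) by simp
    ultimately show False using inf by blast
  qed
  from *[of i j] *[of j i] \<open>P [^] i = P [^] j\<close> show "i = j" by fastforce
qed simp

text \<open>Multiplication by a common denominator \<open>D\<close> lands in the multiples of
  \<open>P\<close>, and \<open>D x = f(x) P\<close> defines a homomorphism to the integers whose
  kernel is the torsion subgroup. Its image is infinite cyclic, so the group splits.\<close>

lemma has_rank_1:
  assumes fg: "finitely_generated_group G"
    and P: "P \<in> carrier G" and inf: "\<And>n::nat. n > 0 \<Longrightarrow> P [^] n \<noteq> \<one>"
    and comm: "\<And>x. x \<in> carrier G \<Longrightarrow> \<exists>n::nat. n > 0 \<and> (\<exists>i::int. x [^] n = P [^] i)"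
  shows "has_rank G 1"
proof -
  note Peq = int_pow_eq_iff_of_infinite_order[OF P inf]
  obtain S where S: "finite S" "S \<subseteq> carrier G" "generate G S = carrier G"
    using fg unfolding finitely_generated_group_def by blast
  obtain n where n: "\<And>x. x \<in> S \<Longrightarrow> n x > (0::nat) \<and> (\<exists>i::int. x [^] n x = P [^] i)"
    using comm S by (metis subsetD)
  define D where "D = (\<Prod>x\<in>S. n x)"
  have "D > 0" unfolding D_def using n by (intro prod_pos) auto
  have sub: "subgroup {x \<in> carrier G. \<exists>i::int. x [^] D = P [^] i} G"
  proof (rule subgroupI)
    show "{x \<in> carrier G. \<exists>i::int. x [^] D = P [^] i} \<noteq> {}"
      by (intro ex_in_conv[THEN iffD1] exI[of _ \<one>]) (auto intro!: exI[of _ "0::int"])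
  next
    fix x assume "x \<in> {x \<in> carrier G. \<exists>i::int. x [^] D = P [^] i}"
    then obtain i :: int where x: "x \<in> carrier G" "x [^] D = P [^] i" by auto
    then have "inv x [^] D = P [^] (- i)" using P by (simp add: nat_pow_inv int_pow_neg)
    with x show "inv x \<in> {x \<in> carrier G. \<exists>i::int. x [^] D = P [^] i}" by auto
    fix y assume "y \<in> {x \<in> carrier G. \<exists>i::int. x [^] D = P [^] i}"
    then obtain j :: int where y: "y \<in> carrier G" "y [^] D = P [^] j" by auto
    then have "(x \<otimes> y) [^] D = P [^] (i + j)" using x P by (simp add: nat_pow_distrib int_pow_mult)
    with x y show "x \<otimes> y \<in> {x \<in> carrier G. \<exists>i::int. x [^] D = P [^] i}" by auto
  qed auto
  have "S \<subseteq> {x \<in> carrier G. \<exists>i::int. x [^] D = P [^] i}"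
  proof
    fix x assume x: "x \<in> S"
    obtain i :: int where i: "x [^] n x = P [^] i" using n x by blast
    define d where "d = (\<Prod>y\<in>S - {x}. n y)"
    have D: "D = n x * d" unfolding D_def d_def using prod.remove[OF S(1) x] by simp
    have "x [^] D = (x [^] n x) [^] d" unfolding D using x S by (simp add: nat_pow_pow subset_iff)
    also have "\<dots> = P [^] (i * int d)" unfolding i using P by (simp add: int_pow_pow flip: int_pow_int)
    finally show "x \<in> {x \<in> carrier G. \<exists>i::int. x [^] D = P [^] i}" using x S by auto
  qed
  then have "carrier G \<subseteq> {x \<in> carrier G. \<exists>i::int. x [^] D = P [^] i}"
    using generate_subgroup_incl[OF _ sub] S(3) by blast
  then obtain f where f: "\<And>x. x \<in> carrier G \<Longrightarrow> x [^] D = P [^] (f x :: int)"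
    by (auto simp: subset_iff) metis
  have f_mult: "f (x \<otimes> y) = f x + f y" if "x \<in> carrier G" "y \<in> carrier G" for x y
  proof -
    have "P [^] f (x \<otimes> y) = P [^] (f x + f y)"
      using that f[of x] f[of y] f[of "x \<otimes> y"] P by (simp add: nat_pow_distrib int_pow_mult)
    then show ?thesis using Peq by simp
  qed
  have f_pow: "f (x [^] i) = i * f x" if "x \<in> carrier G" for x and i :: int
  proof -
    have "P [^] f (x [^] i) = (x [^] i) [^] int D" using that f by (simp add: int_pow_int)
    also have "\<dots> = (x [^] int D) [^] i" using that by (simp add: int_pow_pow mult.commute)
    also have "\<dots> = P [^] (i * f x)" using that f P by (simp add: int_pow_int int_pow_pow mult.commute)
    finally show ?thesis using Peq by simp
  qed
  have f_tors: "f x = 0 \<longleftrightarrow> (\<exists>n::nat. n > 0 \<and> x [^] n = \<one>)" if x: "x \<in> carrier G" for x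
  proof
    assume "f x = 0"
    then have "x [^] D = \<one>" using f x by simp
    with \<open>D > 0\<close> show "\<exists>n::nat. n > 0 \<and> x [^] n = \<one>" by blast
  next
    assume "\<exists>n::nat. n > 0 \<and> x [^] n = \<one>"
    then obtain n :: nat where n: "n > 0" "x [^] int n = \<one>" by (auto simp: int_pow_int)
    have "f \<one> = 0" using f_mult[of \<one> \<one>] by simp
    with f_pow[OF x, of "int n"] n show "f x = 0" by simp
  qed
  have "f P = int D"
    using f[OF P] Peq[of "int D" "f P"] by (simp add: int_pow_int)
  \<comment> \<open>The least positive value of \<open>f\<close> generates its image, and a preimage
    \<open>Q\<close> generates the free part. \<open>P\<close> may be a proper multiple of such a
    \<open>Q\<close> up to torsion; the value \<open>f P = D\<close> only shows that positive values
    exist.\<close>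
  define g where "g = (LEAST k::nat. k > 0 \<and> (\<exists>x\<in>carrier G. f x = int k))"
  have g: "g > 0 \<and> (\<exists>x\<in>carrier G. f x = int g)"
    unfolding g_def by (rule LeastI[of _ D]) (use \<open>f P = int D\<close> \<open>D > 0\<close> P in auto)
  then obtain Q where Q: "Q \<in> carrier G" "f Q = int g" by blast
  have dvd: "f x = (f x div int g) * int g" if x: "x \<in> carrier G" for x
  proof -
    have "f (x \<otimes> Q [^] (- (f x div int g))) = f x mod int g"
      using x Q by (simp add: f_mult f_pow minus_div_mult_eq_mod[symmetric])
    moreover have "f x mod int g = int (nat (f x mod int g))" "nat (f x mod int g) < g"
      using g by (auto simp: nat_less_iff)
    ultimately have "\<not> nat (f x mod int g) > 0"
      using not_less_Least[of "nat (f x mod int g)" "\<lambda>k. k > 0 \<and> (\<exists>x\<in>carrier G. f x = int k)"]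
        x Q unfolding g_def[symmetric] by (metis int_pow_closed m_closed)
    then have "f x mod int g = 0" using g by (simp add: pos_mod_sign dual_order.antisym)
    then show ?thesis using div_mult_mod_eq[of "f x" "int g"] by simp
  qed
  define Z where "Z = product_group {..<1::nat} (\<lambda>_. integer_group)"
  define H where "H = torsion_group G"
  have H: "carrier H = {x \<in> carrier G. f x = 0}" "monoid.mult H = monoid.mult G"
    unfolding H_def torsion_group_def using f_tors by auto
  have Zc: "carrier Z = {..<1} \<rightarrow>\<^sub>E UNIV" 
    "monoid.mult Z = (\<lambda>x y. \<lambda>i\<in>{..<1}. x i + y i)"
    unfolding Z_def by (auto simp: product_group_def integer_group_def)
  \<comment> \<open>An element of the product over \<open>{..<1}\<close> is an extensional function,
    hence determined by its value at 0.\<close>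
  define \<phi> where "\<phi> = (\<lambda>(z :: nat \<Rightarrow> int, t). Q [^] z 0 \<otimes> t)"
  have "\<phi> \<in> iso (Z \<times>\<times> H) G"
  proof (rule isoI)
    show "\<phi> \<in> hom (Z \<times>\<times> H) G"
    proof (rule homI)
      fix x y assume "x \<in> carrier (Z \<times>\<times> H)" "y \<in> carrier (Z \<times>\<times> H)"
      then show "\<phi> (x \<otimes>\<^bsub>Z \<times>\<times> H\<^esub> y) = \<phi> x \<otimes> \<phi> y"
        using Q by (cases x; cases y) (auto simp: \<phi>_def H Zc mult_DirProd int_pow_mult m_ac)
    qed (use Q in \<open>auto simp: \<phi>_def H\<close>)
    have "inj_on \<phi> (carrier (Z \<times>\<times> H))"
    proof (rule inj_onI)
      fix x y assume xy: "x \<in> carrier (Z \<times>\<times> H)" "y \<in> carrier (Z \<times>\<times> H)" "\<phi> x = \<phi> y"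
      obtain z t z' t' where [simp]: "x = (z, t)" "y = (z', t')" by (cases x; cases y) auto
      have zt: "z \<in> {..<1} \<rightarrow>\<^sub>E UNIV" "z' \<in> {..<1} \<rightarrow>\<^sub>E UNIV" "t \<in> carrier G" "t' \<in> carrier G"
          "f t = 0" "f t' = 0" and e: "Q [^] z 0 \<otimes> t = Q [^] z' 0 \<otimes> t'"
        using xy by (auto simp: \<phi>_def H Zc)
      have "f (Q [^] z 0 \<otimes> t) = f (Q [^] z' 0 \<otimes> t')" using e by simp
      then have z0: "z 0 = z' 0" using zt Q g by (simp add: f_mult f_pow)
      then have "z = z'" by (intro PiE_ext[OF zt(1,2)]) auto
      moreover have "t = t'" using e zt Q unfolding z0 by simp
      ultimately show "x = y" by simp
    qed
    moreover have "x \<in> \<phi> ` carrier (Z \<times>\<times> H)" if x: "x \<in> carrier G" for x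
    proof
      define i where "i = f x div int g"
      let ?t = "Q [^] (- i) \<otimes> x"
      have "f ?t = 0" using x Q dvd[OF x] by (simp add: f_mult f_pow i_def)
      then show "((\<lambda>j\<in>{..<1}. i), ?t) \<in> carrier (Z \<times>\<times> H)"
        using x Q by (auto simp: Zc H)
      show "x = \<phi> ((\<lambda>j\<in>{..<1}. i), ?t)"
        using x Q by (simp add: \<phi>_def int_pow_neg flip: m_assoc)
    qed
    moreover have "\<phi> ` carrier (Z \<times>\<times> H) \<subseteq> carrier G" using Q by (auto simp: \<phi>_def H)
    ultimately show "bij_betw \<phi> (carrier (Z \<times>\<times> H)) (carrier G)"
      unfolding bij_betw_def by blast
  qed
  moreover have "group (Z \<times>\<times> H)"
  proof (rule DirProd_group)
    show "group Z" unfolding Z_def by (rule product_group) auto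
    have "subgroup {x \<in> carrier G. f x = 0} G"
    proof (rule subgroupI)
      show "{x \<in> carrier G. f x = 0} \<noteq> {}" using f_mult[of \<one> \<one>] by force
    next
      fix x assume "x \<in> {x \<in> carrier G. f x = 0}"
      then show "inv x \<in> {x \<in> carrier G. f x = 0}"
        using f_pow[of x "-1"] by (simp add: int_pow_neg)
    qed (auto simp: f_mult)
    moreover have "H = G\<lparr>carrier := {x \<in> carrier G. f x = 0}\<rparr>"
      unfolding H_def torsion_group_def
      using f_tors by (intro arg_cong[of _ _ "\<lambda>A. G\<lparr>carrier := A\<rparr>"]) blast
    ultimately show "group H" using subgroup_imp_group by metis
  qed
  ultimately have "G \<cong> Z \<times>\<times> H"
    using group.iso_sym is_isoI by blast
  then show ?thesis
    unfolding has_rank_def Z_def H_def using fg comm_group_axioms by blast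
qed

end

section \<open>Square classes\<close>

lemma squarefree_dvd_square_imp_dvd:
  fixes g w :: int
  assumes "squarefree g" "g dvd w\<^sup>2"
  shows "g dvd w"
proof (cases "w = 0")
  case False
  have "g \<noteq> 0" using assms(1) by auto
  show ?thesis
  proof (subst prime_multiplicity_le_imp_dvd[OF \<open>g \<noteq> 0\<close> False], intro allI impI)
    fix q :: int assume q: "prime q"
    have "multiplicity q g \<le> multiplicity q (w\<^sup>2)"
      using assms(2) False by (intro dvd_imp_multiplicity_le) auto
    also have "multiplicity q (w\<^sup>2) = 2 * multiplicity q w"
      using q False by (intro prime_elem_multiplicity_power_distrib) auto
    finally have "multiplicity q g \<le> 2 * multiplicity q w" .
    moreover have "multiplicity q g \<le> 1"
      using assms(1) q squarefree_factorial_semiring''[OF \<open>g \<noteq> 0\<close>] by blast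
    ultimately show "multiplicity q g \<le> multiplicity q w" by linarith
  qed
qed simp

text \<open>\<open>g\<close> is the squarefree part of \<open>A\<close>. Cancelling the square part
  leaves \<open>g B = w^2\<close>, and \<open>g\<close> divides \<open>w\<close> because it is
  squarefree.\<close>

lemma product_eq_square_imp:
  fixes A B u :: int
  assumes "A * B = u\<^sup>2" "A \<noteq> 0"
  obtains g M N where "squarefree g" "A = g * M\<^sup>2" "B = g * N\<^sup>2"
proof -
  define g where "g = squarefree_part A"
  define M where "M = square_part A"
  have A: "A = g * M\<^sup>2" and g: "squarefree g"
    unfolding g_def M_def by (rule squarefree_decompose) auto
  have "M \<noteq> 0" "g \<noteq> 0" using A assms(2) by auto
  have "M\<^sup>2 dvd u\<^sup>2" unfolding assms(1)[symmetric] A by simp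
  then obtain w where w: "u = M * w" by auto
  have "M\<^sup>2 * (g * B) = M\<^sup>2 * w\<^sup>2" using assms(1) unfolding A w by (simp add: algebra_simps power2_eq_square)
  with \<open>M \<noteq> 0\<close> have gB: "g * B = w\<^sup>2" by simp
  then have "g dvd w" using squarefree_dvd_square_imp_dvd[OF g] by (metis dvd_triv_left)
  then obtain N where "w = g * N" by auto
  with gB \<open>g \<noteq> 0\<close> have "B = g * N\<^sup>2" by (simp add: power2_eq_square)
  with A g show ?thesis by (intro that)
qed

lemma rat_power2_eq_of_int:
  fixes t :: rat
  assumes "t\<^sup>2 = of_int k"
  obtains u where "t = of_int u"
proof -
  obtain m n where q: "quotient_of t = (m, n)" by force
  then have "n > 0" "coprime m n" and t: "t = of_int m / of_int n"
    using quotient_of_denom_pos quotient_of_coprime quotient_of_div by blast+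
  then have "rat_of_int m = t * of_int n" by simp
  then have "rat_of_int (m\<^sup>2) = of_int (k * n\<^sup>2)"
    using assms by (simp add: power_mult_distrib)
  then have "n dvd m\<^sup>2" by (metis dvd_mult dvd_refl dvd_power of_int_eq_iff pos2)
  then have "is_unit n" using \<open>coprime m n\<close>
    by (metis coprime_absorb_left coprime_commute coprime_power_left_iff zero_neq_numeral)
  then have "t = of_int m" using t \<open>n > 0\<close> by simp
  then show ?thesis by (rule that)
qed

text \<open>Peels one prime off a divisor. Iterated as an elimination rule, it lists the divisors of
  \<open>5 p\<close> and of \<open>20 p\<close>.\<close>

lemma prime_dvd_mult_cases:
  fixes g m q :: int
  assumes "prime q" "g dvd q * m"
  obtains "g dvd m" | h where "g = q * h" "h dvd m"
proof (cases "q dvd g")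
  case True
  then obtain h where "g = q * h" by auto
  with assms have "h dvd m" by (simp add: prime_gt_0_int)
  with \<open>g = q * h\<close> show ?thesis by (rule that(2))
next
  case False
  then have "coprime g q" using prime_imp_coprime[OF assms(1)] coprime_commute by blast
  then show ?thesis using assms(2) by (intro that(1)) (simp add: coprime_dvd_mult_right_iff)
qed

text \<open>For \<open>x = r / s\<close> in lowest terms, \<open>(r s) (r^2 + c s^2)\<close> is a
  square, and \<open>g\<close> is the common squarefree part of the two factors. A divisor of
  \<open>g\<close> and \<open>s\<close> would divide \<open>r^2\<close>, so \<open>g\<close> is
  prime to \<open>s\<close> and hence divides \<open>r\<close> and \<open>c\<close>. This leaves
  finitely many classes, and the equation \<open>r^2 + c s^2 = g N^2\<close> is the one to be tested
  locally.\<close>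

lemma descent_square_class:
  fixes x y :: rat and c :: int
  assumes xy: "y\<^sup>2 = x * (x\<^sup>2 + of_int c)" and "x \<noteq> 0"
  obtains r s g M N where "s > 0" "coprime r s" "x = of_int r / of_int s" "r * s = g * M\<^sup>2"
    "r\<^sup>2 + c * s\<^sup>2 = g * N\<^sup>2" "squarefree g" "g dvd r" "g dvd c" "coprime g s"
    "x = of_int g * (of_int M / of_int s)\<^sup>2"
proof -
  obtain r s where q: "quotient_of x = (r, s)" by force
  then have s: "s > 0" and cop: "coprime r s" and x: "x = of_int r / of_int s"
    using quotient_of_denom_pos quotient_of_coprime quotient_of_div by blast+
  have "(y * of_int s ^ 2)\<^sup>2 = y\<^sup>2 * of_int s ^ 4" by (simp add: power_mult_distrib flip: power_mult)
  also have "\<dots> = of_int ((r * s) * (r\<^sup>2 + c * s\<^sup>2))"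
    unfolding xy x using s by (simp add: field_simps power2_eq_square power4_eq_xxxx)
  finally have *: "(y * of_int s ^ 2)\<^sup>2 = of_int ((r * s) * (r\<^sup>2 + c * s\<^sup>2))" .
  then obtain u where "y * of_int s ^ 2 = of_int u" by (rule rat_power2_eq_of_int)
  with * have "(r * s) * (r\<^sup>2 + c * s\<^sup>2) = u\<^sup>2" by (metis of_int_eq_iff of_int_power)
  moreover have "r * s \<noteq> 0" using x \<open>x \<noteq> 0\<close> s by auto
  ultimately obtain g M N where g: "squarefree g" "r * s = g * M\<^sup>2" "r\<^sup>2 + c * s\<^sup>2 = g * N\<^sup>2"
    by (rule product_eq_square_imp)
  have gs: "coprime g s"
  proof (rule coprimeI)
    fix e assume e: "e dvd g" "e dvd s"
    then have "e dvd (r\<^sup>2 + c * s\<^sup>2) - c * s\<^sup>2"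
      unfolding g(3) by (intro dvd_diff) (auto simp: power2_eq_square)
    then have "e dvd r\<^sup>2" by simp
    moreover have "coprime (r\<^sup>2) s" using cop by simp
    ultimately show "is_unit e" using e(2) coprime_common_divisor by blast
  qed
  have "g dvd r * s" unfolding g by simp
  then have gr: "g dvd r" using gs by (simp add: coprime_dvd_mult_left_iff)
  then have "g dvd (r\<^sup>2 + c * s\<^sup>2) - r\<^sup>2" unfolding g(3)
    by (intro dvd_diff) (auto simp: power2_eq_square)
  then have gc: "g dvd c" using gs by (simp add: coprime_dvd_mult_left_iff)
  have "x = of_int (r * s) / (of_int s)\<^sup>2" using s by (simp add: x power2_eq_square)
  then have "x = of_int g * (of_int M / of_int s)\<^sup>2"
    unfolding g by (simp add: power_divide)
  with s cop x g gr gc gs show ?thesis by (intro that)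
qed

lemma nonresidue_5:
  fixes a b c :: int
  assumes "c mod 5 = 2 \<or> c mod 5 = 3" "5 dvd a\<^sup>2 - c * b\<^sup>2"
  shows "5 dvd a" "5 dvd b"
proof -
  have "x mod 5 \<in> {0,1,2,3,4}" for x :: int
    using pos_mod_bound[of 5 x] pos_mod_sign[of 5 x] by auto
  then have "a mod 5 \<in> {0,1,2,3,4}" "b mod 5 \<in> {0,1,2,3,4}" by blast+
  moreover have "((a mod 5)\<^sup>2 - (c mod 5) * (b mod 5)\<^sup>2) mod 5 = (a\<^sup>2 - c * b\<^sup>2) mod 5"
    by (intro mod_diff_cong mod_mult_cong) (simp_all add: power_mod)
  then have "((a mod 5)\<^sup>2 - (c mod 5) * (b mod 5)\<^sup>2) mod 5 = 0"
    using assms(2) by (simp only: dvd_eq_mod_eq_0)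
  ultimately have "a mod 5 = 0 \<and> b mod 5 = 0"
    using assms(1) by (elim insertE disjE emptyE) simp_all
  then show "5 dvd a" "5 dvd b" by (auto simp: dvd_eq_mod_eq_0)
qed

lemma sum_two_squares_mod_4:
  fixes a b c d :: int
  assumes "a\<^sup>2 + b\<^sup>2 = c * d\<^sup>2" "c mod 4 = 3"
  shows "even a" "even b" "even d"
proof -
  have sq: "x\<^sup>2 mod 4 = (if even x then 0 else 1)" for x :: int
  proof (cases "even x")
    case True then show ?thesis by (auto elim!: evenE simp: power2_eq_square)
  next
    case False 
    then obtain k where "x = 2 * k + 1" by (elim oddE)
    then have "x\<^sup>2 = 4 * (k\<^sup>2 + k) + 1" by (simp add: power2_eq_square algebra_simps)
    then show ?thesis using False by presburger
  qed
  have "(a\<^sup>2 mod 4 + b\<^sup>2 mod 4) mod 4 = ((c mod 4) * (d\<^sup>2 mod 4)) mod 4"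
    using assms(1) by (metis mod_add_eq mod_mult_eq)
  then show "even a" "even b" "even d" unfolding sq assms(2) by (auto split: if_splits)
qed

section \<open>Local conditions modulo 4 and 5 on the square classes\<close>

locale special_prime =
  fixes p m :: int
  assumes p: "prime p" and p5: "p mod 5 = 2 \<or> p mod 5 = 3"
    and pm: "p = 8 * m\<^sup>2 - 5"
begin

lemma p_gt_0: "p > 0" using p by (rule prime_gt_0_int)

lemma p8: "p mod 8 = 3"
proof -
  have "(8 * t - 5) mod 8 = 3" for t :: int by presburger
  then show ?thesis by (subst pm)
qed

lemma prime_5: "prime (5::int)" by simp

lemma prime_2: "prime (2::int)" by simp

lemma five_not_dvd_p: "\<not> 5 dvd p" using p5 by (auto simp: dvd_eq_mod_eq_0)

text \<open>If 5 divides \<open>r\<close> and \<open>N\<close>, both outer terms are divisible by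
  25, while the middle one shows a single factor 5 besides \<open>s^2\<close>. The conclusion
  contradicts coprimality of \<open>r\<close> and \<open>s\<close> wherever it is applied.\<close>

lemma five_dvd_step:
  assumes "5 dvd r" "5 dvd N" "r\<^sup>2 + 5 * e * s\<^sup>2 = k * N\<^sup>2" "\<not> 5 dvd e"
  shows "5 dvd (s::int)"
proof -
  obtain r' N' where "r = 5 * r'" "N = 5 * N'" using assms(1,2) by (meson dvdE)
  with assms(3) have "e * s\<^sup>2 = 5 * (k * N'\<^sup>2 - r'\<^sup>2)" by (simp add: power2_eq_square algebra_simps)
  then have "5 dvd e * s\<^sup>2" by simp
  then show ?thesis using assms(4) prime_5 by (metis prime_dvd_mult_iff prime_dvd_power)
qed

text \<open>Of the eight squarefree classes dividing \<open>5 p\<close>, the four given by 5 and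
  \<open>p\<close> with either sign fail modulo 5, while -1 and \<open>5 p\<close> fail modulo 4.
  The survivors 1 and \<open>-5 p\<close> are the classes of P0 and P0 + T.\<close>

lemma x_square_class:
  fixes x y :: rat
  assumes "y\<^sup>2 = x * (x\<^sup>2 - 5 * of_int p)" "x \<noteq> 0"
  shows "\<exists>w. x = w\<^sup>2 \<or> x = - 5 * of_int p * w\<^sup>2"
proof -
  have "y\<^sup>2 = x * (x\<^sup>2 + of_int (- 5 * p))" using assms(1) by simp
  then obtain r s g M N where s: "s > 0" and cop: "coprime r s" and rs: "r * s = g * M\<^sup>2"
    and eq: "r\<^sup>2 + (- 5 * p) * s\<^sup>2 = g * N\<^sup>2" and g: "squarefree g" "g dvd r" "g dvd - 5 * p" "coprime g s"
    and x: "x = of_int g * (of_int M / of_int s)\<^sup>2"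
    using assms(2) by (rule descent_square_class) 
  have c5: "\<not> (5 dvd r \<and> 5 dvd s)" using cop by (meson coprime_common_divisor not_prime_unit prime_5)
  have c2: "\<not> (even r \<and> even s)" using cop by (meson coprime_common_divisor not_prime_unit prime_2)
  \<comment> \<open>Both signs can be treated at once because -1 is a square modulo 5, so that
    \<open>p\<close> and \<open>-p\<close> are nonresidues together.\<close>
  have g5e: "g \<noteq> 5 * e" if "e = 1 \<or> e = -1" for e
  proof
    assume g5: "g = 5 * e"
    then obtain r' where r: "r = 5 * r'" using g(2) that by auto
    have "e * e = 1" using that by auto
    have "5 * (5 * r'\<^sup>2 - p * s\<^sup>2) = 5 * (e * N\<^sup>2)"
      using eq unfolding g5 r by (simp add: power2_eq_square algebra_simps)
    then have "e * (5 * r'\<^sup>2 - p * s\<^sup>2) = e * e * N\<^sup>2" by simp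
    then have "N\<^sup>2 - (- (e * p)) * s\<^sup>2 = 5 * (e * r'\<^sup>2)"
      unfolding \<open>e * e = 1\<close> by (simp add: algebra_simps)
    then have "5 dvd N\<^sup>2 - (- (e * p)) * s\<^sup>2" by simp
    moreover have "(- (e * p)) mod 5 = 2 \<or> (- (e * p)) mod 5 = 3" using that p5 by auto presburger+
    ultimately have "5 dvd s" using nonresidue_5 by blast
    with c5 r show False by simp
  qed
  have gep: "g \<noteq> e * p" if "e = 1 \<or> e = -1" for e
  proof
    assume g5: "g = e * p"
    have "r\<^sup>2 - (e * p) * N\<^sup>2 = 5 * (p * s\<^sup>2)" using eq unfolding g5 by (simp add: algebra_simps)
    then have "5 dvd r\<^sup>2 - (e * p) * N\<^sup>2" by simp
    moreover have "(e * p) mod 5 = 2 \<or> (e * p) mod 5 = 3" using that p5 by auto presburger+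
    ultimately have "5 dvd r" "5 dvd N" using nonresidue_5 by blast+
    moreover have "r\<^sup>2 + 5 * (- p) * s\<^sup>2 = (e * p) * N\<^sup>2" using eq unfolding g5 by simp
    ultimately have "5 dvd s" using five_dvd_step five_not_dvd_p by (metis dvd_minus_iff)
    with c5 \<open>5 dvd r\<close> show False by simp
  qed
  have "g dvd 5 * (p * 1)" using g(3) by simp
  then have "g \<in> {1, -1, 5, -5, p, -p, 5 * p, -5 * p}"
    by (elim prime_dvd_mult_cases[OF prime_5] prime_dvd_mult_cases[OF p]) (auto simp: abs_if split: if_splits)
  moreover have "g \<noteq> -1"
  proof
    assume "g = -1"
    then have "r\<^sup>2 + N\<^sup>2 = 5 * p * s\<^sup>2" using eq by simp
    moreover have "(5 * p) mod 4 = 3" using p8 by presburger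
    ultimately have "even r" "even s" using sum_two_squares_mod_4 by blast+
    with c2 show False by simp
  qed
  moreover have "g \<noteq> 5 * p"
  proof
    assume g5: "g = 5 * p"
    then obtain r' where r: "r = 5 * p * r'" using g(2) by auto
    have "(5 * p) * (N\<^sup>2 + s\<^sup>2) = (5 * p) * (5 * p * r'\<^sup>2)"
      using eq unfolding g5 r by (simp add: power2_eq_square algebra_simps)
    then have "N\<^sup>2 + s\<^sup>2 = 5 * p * r'\<^sup>2" using p_gt_0 by simp
    moreover have "(5 * p) mod 4 = 3" using p8 by presburger
    ultimately have "even s" "even r'" using sum_two_squares_mod_4 by blast+
    with c2 r show False by simp
  qed
  ultimately have "g = 1 \<or> g = - 5 * p"
    using g5e[of 1] g5e[of "-1"] gep[of 1] gep[of "-1"] by auto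
  then show ?thesis using x by auto
qed

text \<open>The curve \<open>Y\<^sup>2 = X\<^sup>3 + 20 p X\<close> is 2-isogenous to \<open>y\<^sup>2 = x\<^sup>3 - 5 p x\<close>.\<close>

lemma isogenous_square_class:
  fixes X Y :: rat
  assumes "Y\<^sup>2 = X * (X\<^sup>2 + 20 * of_int p)" "X > 0"
  shows "\<exists>w. X = w\<^sup>2 \<or> X = 10 * w\<^sup>2 \<or> X = 5 * of_int p * w\<^sup>2 \<or> X = 2 * of_int p * w\<^sup>2"
proof -
  have "Y\<^sup>2 = X * (X\<^sup>2 + of_int (20 * p))" "X \<noteq> 0" using assms by simp_all
  then obtain r s g M N where s: "s > 0" and cop: "coprime r s" and Xr: "X = of_int r / of_int s"
    and rs: "r * s = g * M\<^sup>2"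
    and eq: "r\<^sup>2 + (20 * p) * s\<^sup>2 = g * N\<^sup>2" and g: "squarefree g" "g dvd r" "g dvd 20 * p" "coprime g s"
    and x: "X = of_int g * (of_int M / of_int s)\<^sup>2"
    by (rule descent_square_class) 
  have eq': "r\<^sup>2 + 5 * (4 * p) * s\<^sup>2 = g * N\<^sup>2" using eq by simp
  have c5: "\<not> (5 dvd r \<and> 5 dvd s)" using cop by (meson coprime_common_divisor not_prime_unit prime_5)
  have gpos: "g > 0" using assms(2) x by (simp add: zero_less_mult_iff)
  have g4: "\<not> (2 * 2 * h dvd g)" for h
    using g(1) squarefreeD[OF g(1), of 2] by (auto dest: dvd_mult_left)
  have "g dvd 2 * (2 * (5 * (p * 1)))" using g(3) by simp
  \<comment> \<open>\<open>X > 0\<close> makes \<open>g\<close> positive, and \<open>g4\<close>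
    removes the multiples of 4. Of the eight candidates, 2, 5, \<open>p\<close> and
    \<open>10 p\<close> will fail modulo 5; the others form the group generated by the classes of 10
    and \<open>5 p\<close>.\<close>
  then have "g \<in> {1, 2, 5, 10, p, 2 * p, 5 * p, 10 * p}"
    using gpos p_gt_0 g4[of 1] g4[of p] g4[of 5] g4[of "5 * p"] g4[of "-1"] g4[of "-p"]
    by (elim prime_dvd_mult_cases[OF prime_2] prime_dvd_mult_cases[OF prime_5]
      prime_dvd_mult_cases[OF p]) (auto simp: zero_less_mult_iff abs_if split: if_splits)
  moreover have "g \<noteq> 5"
  proof
    assume g5: "g = 5"
    then obtain r' where r: "r = 5 * r'" using g(2) by auto
    have "N\<^sup>2 - (4 * p) * s\<^sup>2 = 5 * r'\<^sup>2"
      using eq unfolding g5 r by (simp add: power2_eq_square algebra_simps)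
    then have "5 dvd N\<^sup>2 - (4 * p) * s\<^sup>2" by simp
    moreover have "(4 * p) mod 5 = 2 \<or> (4 * p) mod 5 = 3" using p5 by presburger
    ultimately have "5 dvd s" using nonresidue_5 by blast
    with c5 r show False by simp
  qed
  moreover have "g \<noteq> 10 * p"
  proof
    assume g5: "g = 10 * p"
    then obtain r' where r: "r = 10 * p * r'" using g(2) by auto
    have "(10 * p) * (N\<^sup>2 - 2 * s\<^sup>2) = (10 * p) * (5 * (2 * p * r'\<^sup>2))"
      using eq unfolding g5 r by (simp add: power2_eq_square algebra_simps)
    then have "N\<^sup>2 - 2 * s\<^sup>2 = 5 * (2 * p * r'\<^sup>2)" using p_gt_0 by simp
    then have "5 dvd N\<^sup>2 - 2 * s\<^sup>2" by simp
    then have "5 dvd s" using nonresidue_5[of 2 N s] by simp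
    with c5 r show False by simp
  qed
  moreover have "\<not> (g mod 5 = 2 \<or> g mod 5 = 3)"
  proof
    assume g5: "g mod 5 = 2 \<or> g mod 5 = 3"
    have "r\<^sup>2 - g * N\<^sup>2 = 5 * (- 4 * p * s\<^sup>2)" using eq by simp
    then have "5 dvd r\<^sup>2 - g * N\<^sup>2" by simp
    then have "5 dvd r" "5 dvd N" using nonresidue_5 g5 by blast+
    moreover have "\<not> 5 dvd 4 * p" using p5 by presburger
    ultimately have "5 dvd s" using five_dvd_step[OF _ _ eq'] by blast
    with c5 \<open>5 dvd r\<close> show False by simp
  qed
  then have "g \<noteq> 2" "g \<noteq> p" using p5 by auto
  ultimately have "g = 1 \<or> g = 10 \<or> g = 5 * p \<or> g = 2 * p" by auto
  then show ?thesis using x by auto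
qed

end

section \<open>Halving points\<close>

text \<open>
  In the next three lemmas a point with square abscissa is written \<open>(w\<^sup>2, w v)\<close>. It is the image
  of the point with abscissa \<open>2 (w\<^sup>2 + v)\<close> on the isogenous curve \<open>Y\<^sup>2 = X\<^sup>3 - 4 a X\<close>, and that
  point comes in turn from the original curve iff \<open>2 (w\<^sup>2 + v)\<close> is a square. The last equation of
  \<open>ec_add_halves\<close> is the multiplicativity of this class modulo squares.
\<close>

lemma ec_double_halved:
  fixes a s w v :: "'a::field"
  assumes two: "(2::'a) \<noteq> 0" and "a \<noteq> 0" and v: "v\<^sup>2 = w ^ 4 + a" and s: "2 * (w\<^sup>2 + v) = s\<^sup>2"
  defines "x \<equiv> s\<^sup>2 / 2 + s * w"
  shows "on_curve a 0 (Affine x (s * x))"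
    "ec_add a (Affine x (s * x)) (Affine x (s * x)) = Affine (w\<^sup>2) (w * v)"
proof -
  \<comment> \<open>The half is sought on the line \<open>y = s x\<close> through (0, 0). Its
    abscissa is then a root of \<open>x^2 - s^2 x + a\<close>, whose discriminant
    \<open>s^4 - 4 a\<close> equals \<open>(2 s w)^2\<close>; the chosen \<open>x\<close> is one of
    the two roots.\<close>
  have x: "2 * x = s\<^sup>2 + 2 * s * w" using two unfolding x_def by (simp add: field_simps)
  have "4 * (x\<^sup>2 - s\<^sup>2 * x + a) = (2 * x)\<^sup>2 - 2 * s\<^sup>2 * (2 * x) + 4 * a" by algebra
  also have "\<dots> = 4 * s\<^sup>2 * w\<^sup>2 - s\<^sup>2 * s\<^sup>2 + 4 * a" unfolding x by (simp add: power2_eq_square algebra_simps)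
  also have "\<dots> = 4 * (w ^ 4 - v\<^sup>2 + a)" unfolding s[symmetric]
    by (simp add: power2_eq_square power4_eq_xxxx algebra_simps)
  also have "\<dots> = 0" using v by simp
  finally have "4 * (x\<^sup>2 - s\<^sup>2 * x + a) = 0" .
  moreover have "(4::'a) = 2 * 2" by simp
  ultimately have xa: "x\<^sup>2 - s\<^sup>2 * x + a = 0" using two by (metis mult_eq_0_iff)
  have "(s * x)\<^sup>2 = x ^ 3 + a * x" using xa by algebra
  then show curve: "on_curve a 0 (Affine x (s * x))" by simp
  have "s \<noteq> 0"
  proof
    assume "s = 0"
    then have "w\<^sup>2 + v = 0" using s two by (metis mult_eq_0_iff zero_power2)
    then have "v = - (w\<^sup>2)" by (simp add: add_eq_0_iff)
    then have "v\<^sup>2 = w ^ 4" by simp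
    then show False using v \<open>a \<noteq> 0\<close> by simp
  qed
  moreover have "x \<noteq> 0" using xa \<open>a \<noteq> 0\<close> by auto
  ultimately have "s * x \<noteq> - (s * x)" using two
    by (metis add_eq_0_iff2 mult_2 mult_eq_0_iff)
  then have n: "\<not> (x = x \<and> s * x = - (s * x))" by simp
  have "(s + w) * (s * x + s * x) = x\<^sup>2 + x * x + x\<^sup>2 + a" using xa x by algebra
  then have sec: "secant a x (s * x) x (s * x) (s + w)" by (simp add: secant_def)
  have X: "(s + w)\<^sup>2 - x - x = w\<^sup>2" using x by algebra
  have "2 * ((s + w) * (x - w\<^sup>2) - s * x) = 2 * (w * v)" using x s by algebra
  then have "(s + w) * (x - w\<^sup>2) - s * x = w * v" using two by (metis mult_left_cancel)
  then show "ec_add a (Affine x (s * x)) (Affine x (s * x)) = Affine (w\<^sup>2) (w * v)"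
    using ec_add_secant[OF two curve curve n sec] unfolding X by metis
qed

lemma ec_doubleE:
  fixes a x y :: "'a::field"
  assumes two: "(2::'a) \<noteq> 0" and curve: "on_curve a 0 (Affine x y)" and "y \<noteq> 0"
  obtains w s v where "ec_add a (Affine x y) (Affine x y) = Affine (w\<^sup>2) (w * v)"
    "w = (x\<^sup>2 - a) / (2 * y)" "2 * (w\<^sup>2 + v) = s\<^sup>2"
proof -
  \<comment> \<open>\<open>s^2\<close> is the abscissa of the image on the isogenous curve,
    \<open>w\<close> a square root of the abscissa of the double, and \<open>s + w\<close> the slope
    of the tangent.\<close>
  define s where "s = y / x"
  define w where "w = (x\<^sup>2 - a) / (2 * y)"
  define v where "v = s\<^sup>2 / 2 - w\<^sup>2"
  have y2: "y\<^sup>2 = x ^ 3 + a * x" using curve by simp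
  have "x \<noteq> 0" using y2 \<open>y \<noteq> 0\<close> by auto
  have y: "y = s * x" using \<open>x \<noteq> 0\<close> by (simp add: s_def)
  have "s \<noteq> 0" using \<open>y \<noteq> 0\<close> y by auto
  have "x * (s\<^sup>2 * x) = x * (x\<^sup>2 + a)" using y2 y by algebra
  then have s2: "s\<^sup>2 * x = x\<^sup>2 + a" using \<open>x \<noteq> 0\<close> by simp
  have w: "w * (2 * y) = x\<^sup>2 - a" using two \<open>y \<noteq> 0\<close> by (simp add: w_def)
  have v: "2 * v = s\<^sup>2 - 2 * w\<^sup>2" using two by (simp add: v_def field_simps)
  have "x * (2 * s * w) = x * (2 * x - s\<^sup>2)" using w y s2 by algebra
  then have sw: "2 * x = s\<^sup>2 + 2 * s * w" using \<open>x \<noteq> 0\<close> by simp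
  have "y \<noteq> - y" using two \<open>y \<noteq> 0\<close> by (metis add_eq_0_iff2 mult_2 mult_eq_0_iff)
  then have n: "\<not> (x = x \<and> y = - y)" by simp
  have "(s + w) * (y + y) = x\<^sup>2 + x * x + x\<^sup>2 + a" using s2 sw y by algebra
  then have sec: "secant a x y x y (s + w)" by (simp add: secant_def)
  have X: "(s + w)\<^sup>2 - x - x = w\<^sup>2" using sw by algebra
  have "2 * ((s + w) * (x - w\<^sup>2) - y) = 2 * (w * v)" using sw v y by algebra
  then have "(s + w) * (x - w\<^sup>2) - y = w * v" using two by (metis mult_left_cancel)
  then have "ec_add a (Affine x y) (Affine x y) = Affine (w\<^sup>2) (w * v)"
    using ec_add_secant[OF two curve curve n sec] unfolding X by metis
  moreover have "2 * (w\<^sup>2 + v) = s\<^sup>2" using v by (simp add: algebra_simps)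
  ultimately show ?thesis using w_def by (intro that)
qed

lemma ec_add_halves:
  fixes a w v w1 v1 :: "'a::field"
  assumes two: "(2::'a) \<noteq> 0" and v: "v\<^sup>2 = w ^ 4 + a" "v1\<^sup>2 = w1 ^ 4 + a" and ne: "w\<^sup>2 \<noteq> w1\<^sup>2"
  obtains w3 v3 where "ec_add a (Affine (w\<^sup>2) (w * v)) (Affine (w1\<^sup>2) (w1 * v1)) = Affine (w3\<^sup>2) (w3 * v3)"
    "v3\<^sup>2 = w3 ^ 4 + a"
    "2 * (w3\<^sup>2 + v3) * ((w\<^sup>2 + v) * (w1\<^sup>2 + v1)) = (((w\<^sup>2 + v) * (w1\<^sup>2 + v1) + a) / (w + w1))\<^sup>2"
proof -
  define d where "d = w\<^sup>2 - w1\<^sup>2"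
  have "d \<noteq> 0" using ne by (simp add: d_def)
  define M where "M = (w1 * v1 - w * v) / (w1\<^sup>2 - w\<^sup>2)"
  \<comment> \<open>The three abscissae on a line \<open>y = M x + k\<close> multiply to
    \<open>k^2\<close>, so the third one is the square of \<open>k / (w w1)\<close>.
    \<open>w3\<close> is the negative of this root, written without dividing by
    \<open>w w1\<close>.\<close>
  define w3 where "w3 = (v * w1 - v1 * w) / d"
  define v3 where "v3 = w * w1 - M * w3"
  have M: "M * d = w * v - w1 * v1"
  proof -
    have "M * (w1\<^sup>2 - w\<^sup>2) = w1 * v1 - w * v" using ne by (simp add: M_def)
    then show ?thesis unfolding d_def by algebra
  qed
  have w3: "w3 * d = v * w1 - v1 * w" using \<open>d \<noteq> 0\<close> by (simp add: w3_def)
  have "d\<^sup>2 * (M\<^sup>2 - w\<^sup>2 - w1\<^sup>2) = (M * d)\<^sup>2 - d\<^sup>2 * (w\<^sup>2 + w1\<^sup>2)" by algebra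
  also have "\<dots> = (w3 * d)\<^sup>2" unfolding M w3 unfolding d_def using v by algebra
  finally have "d\<^sup>2 * (M\<^sup>2 - w\<^sup>2 - w1\<^sup>2) = d\<^sup>2 * w3\<^sup>2" by (simp add: power_mult_distrib mult.commute)
  then have X: "M\<^sup>2 - w\<^sup>2 - w1\<^sup>2 = w3\<^sup>2" using \<open>d \<noteq> 0\<close> by simp
  have "d * (M * w\<^sup>2 - w * v) = d * (w * w1 * w3)"
    using M w3 unfolding d_def by algebra
  then have k: "M * w\<^sup>2 - w * v = w * w1 * w3" using \<open>d \<noteq> 0\<close> by simp
  have Y: "M * (w\<^sup>2 - w3\<^sup>2) - w * v = w3 * v3" using k unfolding v3_def by algebra
  have e: "ec_add a (Affine (w\<^sup>2) (w * v)) (Affine (w1\<^sup>2) (w1 * v1)) = Affine (w3\<^sup>2) (w3 * v3)"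
    using ne by (simp only: ec_add.simps Let_def M_def[symmetric] X Y if_False simp_thms)
  have nz: "w + w1 \<noteq> 0" "w - w1 \<noteq> 0" using ne by (auto simp: add_eq_0_iff2)
  have d': "d = (w + w1) * (w - w1)" unfolding d_def by algebra
  have "(w - w1) * ((w3 - M) * (w + w1)) = (w - w1) * (- (v + v1))"
    using M w3 unfolding d' by algebra
  then have wM: "(w3 - M) * (w + w1) = - (v + v1)" using nz by simp
  have "(w - w1) * ((w + w1)\<^sup>2 * (w3\<^sup>2 + v3)) = (w + w1)\<^sup>2 * (w - w1) * (w3 * (w3 - M)) + (w + w1)\<^sup>2 * (w - w1) * (w * w1)"
    unfolding v3_def by algebra
  also have "\<dots> = (w3 * d) * ((w3 - M) * (w + w1)) + (w + w1)\<^sup>2 * (w - w1) * (w * w1)"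
    unfolding d' by algebra
  also have "\<dots> = (w - w1) * (a + v * v1 + w\<^sup>2 * w1\<^sup>2)"
    unfolding wM w3 using v by algebra
  finally have A: "(w + w1)\<^sup>2 * (w3\<^sup>2 + v3) = a + v * v1 + w\<^sup>2 * w1\<^sup>2" 
    using nz by simp
  have "2 * (w3\<^sup>2 + v3) * ((w\<^sup>2 + v) * (w1\<^sup>2 + v1)) * (w + w1)\<^sup>2
      = 2 * ((w + w1)\<^sup>2 * (w3\<^sup>2 + v3)) * ((w\<^sup>2 + v) * (w1\<^sup>2 + v1))" by (simp only: ac_simps)
  also have "\<dots> = ((w\<^sup>2 + v) * (w1\<^sup>2 + v1) + a)\<^sup>2" unfolding A using v by algebra
  finally have B: "2 * (w3\<^sup>2 + v3) * ((w\<^sup>2 + v) * (w1\<^sup>2 + v1)) = (((w\<^sup>2 + v) * (w1\<^sup>2 + v1) + a) / (w + w1))\<^sup>2"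
    unfolding power_divide using nz(1) by (subst eq_divide_eq) simp
  have C: "v3\<^sup>2 = w3 ^ 4 + a"
  \<comment> \<open>For \<open>w3 \<noteq> 0\<close> the curve equation can be divided by
    \<open>w3^2\<close>. For \<open>w3 = 0\<close> the sum is (0, 0), and
    \<open>v3^2 = (w w1)^2 = a\<close> has to be obtained directly.\<close>
  proof (cases "w3 = 0")
    case True
    then have "v * w1 = v1 * w" using w3 by simp
    then have "d * (w * w1)\<^sup>2 = d * a" using v unfolding d_def by algebra
    then show ?thesis using True \<open>d \<noteq> 0\<close> by (simp add: v3_def)
  next
    case False
    have "d * (M * (w * v + w1 * v1)) = d * ((w\<^sup>2)\<^sup>2 + w\<^sup>2 * w1\<^sup>2 + (w1\<^sup>2)\<^sup>2 + a)"
      using M v unfolding d_def by algebra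
    then have "M * (w * v + w1 * v1) = (w\<^sup>2)\<^sup>2 + w\<^sup>2 * w1\<^sup>2 + (w1\<^sup>2)\<^sup>2 + a"
      using \<open>d \<noteq> 0\<close> mult_left_cancel by blast
    moreover have "w1 * v1 - w * v = M * (w1\<^sup>2 - w\<^sup>2)" using M unfolding d_def by algebra
    ultimately have "secant a (w\<^sup>2) (w * v) (w1\<^sup>2) (w1 * v1) M"
      unfolding secant_def by blast
    moreover have "on_curve a 0 (Affine (w\<^sup>2) (w * v))"
      using v(1) by (simp add: power_mult_distrib algebra_simps flip: power_mult power_add)
    ultimately have "on_curve a 0 (Affine (w3\<^sup>2) (w3 * v3))"
      using secant_third(1)[of a 0 "w\<^sup>2" "w * v" "w1\<^sup>2" "w1 * v1" M "w3\<^sup>2" "w3 * v3"] X Y by simp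
    then have "w3\<^sup>2 * v3\<^sup>2 = w3\<^sup>2 * (w3 ^ 4 + a)"
      by (simp add: algebra_simps flip: power_mult power_add)
    then show ?thesis using False by simp
  qed
  show ?thesis using that[OF e C B] .
qed

lemma ec_add_two_torsion:
  fixes a x y :: "'a::field"
  assumes "on_curve a 0 (Affine x y)" "x \<noteq> 0"
  shows "ec_add a (Affine x y) (Affine 0 0) = Affine (a / x) (- a * y / x\<^sup>2)"
proof -
  have y2: "y\<^sup>2 = x ^ 3 + a * x" using assms by simp
  define m where "m = y / x"
  have m: "(0 - y) / (0 - x) = m" by (simp add: m_def)
  have "m\<^sup>2 - x - 0 = a / x"
    unfolding m_def power_divide y2 using assms(2) by (simp add: field_simps power2_eq_square power3_eq_cube)
  moreover have "m * (x - a / x) - y = - a * y / x\<^sup>2"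
    unfolding m_def using assms(2) by (simp add: field_simps power2_eq_square)
  ultimately show ?thesis using assms(2) by (simp only: ec_add.simps m Let_def if_False simp_thms)
qed


section \<open>The curve of the theorem: 2-torsion, doubles and halving up to four cosets\<close>

context special_prime
begin

definition q :: rat where "q = 5 * of_int p"

definition "G = ec_group (- q) 0"

definition T :: "rat point" where "T = Affine 0 0"

definition P0 :: "rat point" where
  "P0 = Affine (4 * of_int m ^ 2) (2 * of_int m * (4 * of_int m ^ 2 - 5))"

lemma q_gt_0: "q > 0" using p_gt_0 by (simp add: q_def)

lemma q_eq: "q = 40 * of_int m ^ 2 - 25"
proof -
  have "rat_of_int p = 8 * of_int m ^ 2 - 5" by (subst pm) simp
  then show ?thesis by (simp add: q_def)
qed

lemma m_neq_0: "m \<noteq> 0" using pm p_gt_0 by auto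

lemma elliptic: "elliptic_curve (- q) 0"
  using q_gt_0 by (simp add: elliptic_curve_def)

sublocale E: nonsingular_cubic "- q" 0
  by standard (rule elliptic)

sublocale G: comm_group G
  unfolding G_def by (rule E.comm_group_ec)

lemma carrier_G: "P \<in> carrier G \<longleftrightarrow> on_curve (- q) 0 P"
  and mult_G: "P \<otimes>\<^bsub>G\<^esub> Q = ec_add (- q) P Q" and one_G: "\<one>\<^bsub>G\<^esub> = Infinity"
  by (simp_all add: G_def ec_group_def)

lemma curve_eq: "on_curve (- q) 0 (Affine x y) \<longleftrightarrow> y\<^sup>2 = x * (x\<^sup>2 - q)"
  by (simp add: algebra_simps power2_eq_square power3_eq_cube)

lemma not_rat_square: "w\<^sup>2 \<noteq> (of_int k :: rat)" if "\<And>u. u\<^sup>2 \<noteq> k" for w k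
proof
  assume e: "w\<^sup>2 = of_int k"
  then obtain u where "w = of_int u" by (rule rat_power2_eq_of_int)
  then have "u\<^sup>2 = k" using e by (metis of_int_eq_iff of_int_power)
  with that show False by blast
qed

lemma prime_times_not_square:
  fixes r k u :: int
  assumes "prime r" "\<not> r dvd k"
  shows "u\<^sup>2 \<noteq> r * k"
proof
  assume e: "u\<^sup>2 = r * k"
  then have "r dvd u" using assms(1) by (metis dvd_triv_left prime_dvd_power)
  then obtain t where "u = r * t" by auto
  then have "r * k = r * (r * t\<^sup>2)" using e by (simp only: power2_eq_square ac_simps)
  then have "k = r * t\<^sup>2" using assms(1) by (metis mult_left_cancel not_prime_0)
  with assms(2) show False by simp
qed

lemma q_not_square: "w\<^sup>2 \<noteq> q"
proof -
  have "w\<^sup>2 \<noteq> of_int (5 * p)" using prime_times_not_square[OF prime_5 five_not_dvd_p] by (intro not_rat_square)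
  then show ?thesis by (simp add: q_def)
qed

lemma y_eq_0_iff:
  assumes "on_curve (- q) 0 (Affine x y)"
  shows "y = 0 \<longleftrightarrow> x = 0"
  using assms q_not_square[of x] unfolding curve_eq by auto

lemma T_in: "T \<in> carrier G" and P0_in: "P0 \<in> carrier G"
proof -
  show "T \<in> carrier G" by (simp add: carrier_G T_def)
  show "P0 \<in> carrier G" unfolding carrier_G P0_def curve_eq q_eq
    by (simp add: power2_eq_square algebra_simps power_numeral_reduce)
qed

lemma rat_two: "(2::rat) \<noteq> 0" by simp

lemma two_torsion:
  assumes "P \<in> carrier G" "P \<otimes>\<^bsub>G\<^esub> P = \<one>\<^bsub>G\<^esub>"
  shows "P = \<one>\<^bsub>G\<^esub> \<or> P = T"
proof (cases P)
  case (Affine x y)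
  have "P = ec_neg P" using assms(2) ec_add_eq_Infinity unfolding mult_G one_G by blast
  then have "y = 0" using Affine by simp
  then have "x = 0" using y_eq_0_iff assms(1) unfolding Affine carrier_G by blast
  then show ?thesis using Affine \<open>y = 0\<close> by (simp add: T_def)
qed (simp add: one_G)

text \<open>The root \<open>w = (x^2 + q) / (2 y)\<close> is nonzero because \<open>q > 0\<close>. A
  positive abscissa already excludes T and P0 + T as doubles; that \<open>2 (w^2 + v)\<close> is a
  square is the finer test needed for P0.\<close>

lemma double_cases:
  assumes "R \<in> carrier G"
  obtains "R \<otimes>\<^bsub>G\<^esub> R = Infinity" | w s v where "w \<noteq> 0" "R \<otimes>\<^bsub>G\<^esub> R = Affine (w\<^sup>2) (w * v)" "2 * (w\<^sup>2 + v) = s\<^sup>2"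
proof (cases R)
  case Infinity
  then show ?thesis using that(1) by (simp add: mult_G)
next
  case (Affine x y)
  show ?thesis
  proof (cases "y = 0")
    case True
    then show ?thesis using Affine that(1) by (simp add: mult_G)
  next
    case False
    have "on_curve (- q) 0 (Affine x y)" using assms Affine carrier_G by simp
    from ec_doubleE[OF rat_two this False] obtain w s v where
      "ec_add (- q) (Affine x y) (Affine x y) = Affine (w\<^sup>2) (w * v)"
      "w = (x\<^sup>2 - - q) / (2 * y)" "2 * (w\<^sup>2 + v) = s\<^sup>2" by metis
    moreover have "x\<^sup>2 + q > 0" using q_gt_0 by (simp add: add_nonneg_pos)
    ultimately show ?thesis using False that(2)[of w v s] Affine by (simp add: mult_G)
  qed
qed

lemma P0_add_T: "P0 \<otimes>\<^bsub>G\<^esub> T = Affine (- q / (4 * of_int m ^ 2))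
    (- (- q) * (2 * of_int m * (4 * of_int m ^ 2 - 5)) / (4 * of_int m ^ 2)\<^sup>2)"
  using ec_add_two_torsion[of "- q" "4 * of_int m ^ 2" "2 * of_int m * (4 * of_int m ^ 2 - 5)"] P0_in m_neq_0
  unfolding carrier_G mult_G P0_def T_def by (simp del: ec_add.simps on_curve.simps)

lemma double_neq:
  assumes R: "R \<in> carrier G"
  shows "R \<otimes>\<^bsub>G\<^esub> R \<noteq> T" "R \<otimes>\<^bsub>G\<^esub> R \<noteq> P0 \<otimes>\<^bsub>G\<^esub> T" "R \<otimes>\<^bsub>G\<^esub> R \<noteq> P0"
proof -
  have "- q / (4 * of_int m ^ 2) < 0" using q_gt_0 m_neq_0 by (simp add: divide_neg_pos)
  then have "w\<^sup>2 \<noteq> - q / (4 * of_int m ^ 2)" for w by (metis not_less zero_le_power2)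
  then show "R \<otimes>\<^bsub>G\<^esub> R \<noteq> P0 \<otimes>\<^bsub>G\<^esub> T" unfolding P0_add_T
    by (rule_tac double_cases[OF R]) auto
  show "R \<otimes>\<^bsub>G\<^esub> R \<noteq> T" unfolding T_def by (rule double_cases[OF R]) auto
  show "R \<otimes>\<^bsub>G\<^esub> R \<noteq> P0"
  proof
    assume e: "R \<otimes>\<^bsub>G\<^esub> R = P0"
    then obtain w s v where w: "w \<noteq> 0" "P0 = Affine (w\<^sup>2) (w * v)" "2 * (w\<^sup>2 + v) = s\<^sup>2"
      using double_cases[OF R] unfolding P0_def by (metis point.distinct(1))
    define M :: rat where "M = of_int m"
    have M: "w\<^sup>2 = (2 * M)\<^sup>2" "w * v = 2 * M * (4 * M\<^sup>2 - 5)"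
      using w(2) unfolding P0_def M_def by (auto simp: power2_eq_square)
    have "M \<noteq> 0" using m_neq_0 by (simp add: M_def)
    from M(1) consider "w = 2 * M" | "w = - (2 * M)" by (metis power2_eq_iff)
    \<comment> \<open>The two square roots of the abscissa of P0 lead to the values
      \<open>2 p\<close> and 10. Each contains the prime 2 exactly once, so neither is a
      square.\<close>
    then have "s\<^sup>2 = 2 * (4 * M\<^sup>2 + (4 * M\<^sup>2 - 5)) \<or> s\<^sup>2 = 10"
    proof cases
      case 1
      then have "v = 4 * M\<^sup>2 - 5" using M(2) \<open>M \<noteq> 0\<close> by simp
      then show ?thesis using w(3) 1 by (simp add: power2_eq_square)
    next
      case 2
      then have "(2 * M) * (- v) = (2 * M) * (4 * M\<^sup>2 - 5)" using M(2) by simp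
      then have "- v = 4 * M\<^sup>2 - 5" using \<open>M \<noteq> 0\<close> by (metis mult_left_cancel mult_eq_0_iff rat_two)
      then have "v = 5 - 4 * M\<^sup>2" by simp
      then show ?thesis using w(3) 2 by (simp add: power2_eq_square)
    qed
    moreover have "2 * (4 * M\<^sup>2 + (4 * M\<^sup>2 - 5)) = of_int (2 * p)" unfolding pm M_def by simp
    moreover have "s\<^sup>2 \<noteq> of_int (2 * p)"
      using p8 by (intro not_rat_square prime_times_not_square prime_2) presburger
    moreover have "s\<^sup>2 \<noteq> of_int (2 * 5)"
      by (intro not_rat_square prime_times_not_square prime_2) simp
    ultimately show False by simp
  qed
qed

lemma P0_infinite_order: "n > 0 \<Longrightarrow> P0 [^]\<^bsub>G\<^esub> (n::nat) \<noteq> \<one>\<^bsub>G\<^esub>"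
  using G.infinite_order_of_non_doubles[OF P0_in T_in] two_torsion double_neq by blast

lemma halve_of_square:
  assumes "v\<^sup>2 = w ^ 4 - q" "2 * (w\<^sup>2 + v) = s\<^sup>2"
  shows "\<exists>R\<in>carrier G. R \<otimes>\<^bsub>G\<^esub> R = Affine (w\<^sup>2) (w * v)"
  using ec_double_halved[OF rat_two, of "- q" v w s] assms q_gt_0 unfolding mult_G
  by (intro bexI[of _ "Affine (s\<^sup>2 / 2 + s * w) (s * (s\<^sup>2 / 2 + s * w))"]) (auto simp only: carrier_G)

lemma curve_halves:
  assumes "on_curve (- q) 0 (Affine (w\<^sup>2) (w * v))" "w \<noteq> 0"
  shows "v\<^sup>2 = w ^ 4 - q"
proof -
  have "w\<^sup>2 * v\<^sup>2 = w\<^sup>2 * (w ^ 4 - q)"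
    using assms(1) unfolding curve_eq by (simp add: power_mult_distrib flip: power_mult)
  then show ?thesis using assms(2) by simp
qed

text \<open>\<open>P0 = (w\<^sup>2, w v)\<close>, where the sign of \<open>w\<close> is chosen so that \<open>2(w\<^sup>2 + v) = 10\<close>.\<close>

lemma halve_of_ten_times_square:
  assumes v: "v\<^sup>2 = w ^ 4 - q" and t: "2 * (w\<^sup>2 + v) = 10 * t\<^sup>2"
  shows "\<exists>R\<in>carrier G. R \<otimes>\<^bsub>G\<^esub> R = Affine (w\<^sup>2) (w * v) \<or> R \<otimes>\<^bsub>G\<^esub> R = Affine (w\<^sup>2) (w * v) \<otimes>\<^bsub>G\<^esub> P0"
proof -
  define w1 v1 :: rat where "w1 = - 2 * of_int m" and "v1 = 5 - 4 * of_int m ^ 2"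
  have P0: "P0 = Affine (w1\<^sup>2) (w1 * v1)"
    unfolding P0_def w1_def v1_def by (simp add: power2_eq_square algebra_simps)
  have "w1 \<noteq> 0" using m_neq_0 by (simp add: w1_def)
  then have v1: "v1\<^sup>2 = w1 ^ 4 - q" using curve_halves P0_in unfolding P0 carrier_G by blast
  have A1: "w1\<^sup>2 + v1 = 5" by (simp add: w1_def v1_def power2_eq_square)
  show ?thesis
  proof (cases "w\<^sup>2 = w1\<^sup>2")
    \<comment> \<open>The chord formula needs distinct abscissae. Otherwise the point is P0 or -P0,
      and P0 respectively the identity serves as \<open>R\<close>.\<close>
    case True
    then have "w ^ 4 = w1 ^ 4" by (metis numeral_Bit0 power_add power2_eq_square mult_2 power_mult)
    then have "v\<^sup>2 = v1\<^sup>2" using v v1 by simp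
    then have "(w * v)\<^sup>2 = (w1 * v1)\<^sup>2" using True by (simp add: power_mult_distrib)
    then consider "w * v = w1 * v1" | "w * v = - (w1 * v1)" by (metis power2_eq_iff)
    then show ?thesis
    proof cases
      case 1
      then have "P0 \<otimes>\<^bsub>G\<^esub> P0 = Affine (w\<^sup>2) (w * v) \<otimes>\<^bsub>G\<^esub> P0" using True P0 by simp
      then show ?thesis using P0_in by blast
    next
      case 2
      then have "Affine (w\<^sup>2) (w * v) = ec_neg P0" using True P0 by simp
      then have "Affine (w\<^sup>2) (w * v) \<otimes>\<^bsub>G\<^esub> P0 = \<one>\<^bsub>G\<^esub>"
        using ec_add_neg_right[of "- q" "ec_neg P0"] by (simp add: mult_G one_G)
      then show ?thesis using G.l_one[OF G.one_closed] by (intro bexI[of _ "\<one>\<^bsub>G\<^esub>"]) auto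
    qed
  next
    case False
    have "v\<^sup>2 = w ^ 4 + - q" "v1\<^sup>2 = w1 ^ 4 + - q" using v v1 by auto
    then obtain w3 v3 where w3: "ec_add (- q) (Affine (w\<^sup>2) (w * v)) (Affine (w1\<^sup>2) (w1 * v1)) = Affine (w3\<^sup>2) (w3 * v3)"
      "v3\<^sup>2 = w3 ^ 4 + - q"
      "2 * (w3\<^sup>2 + v3) * ((w\<^sup>2 + v) * (w1\<^sup>2 + v1)) = (((w\<^sup>2 + v) * (w1\<^sup>2 + v1) + - q) / (w + w1))\<^sup>2"
      using ec_add_halves[OF rat_two _ _ False] by metis
    define k where "k = ((w\<^sup>2 + v) * (w1\<^sup>2 + v1) + - q) / (w + w1)"
    have wv: "w\<^sup>2 + v = 5 * t\<^sup>2" using t by simp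
    have "t \<noteq> 0"
    proof
      assume "t = 0"
      then have "v = - (w\<^sup>2)" using wv by simp
      then have "v\<^sup>2 = w ^ 4" by simp
      then show False using v q_gt_0 by simp
    qed
    \<comment> \<open>Both summands lie in the class of 10, so their sum lies in the trivial class
      and can be halved.\<close>
    have "2 * (w3\<^sup>2 + v3) * (5 * t\<^sup>2 * 5) = k\<^sup>2"
      using w3(3) unfolding k_def A1 wv .
    then have "2 * (w3\<^sup>2 + v3) = (k / (5 * t))\<^sup>2"
      using \<open>t \<noteq> 0\<close> by (simp add: field_simps power2_eq_square)
    moreover have "v3\<^sup>2 = w3 ^ 4 - q" using w3(2) by simp
    ultimately obtain R where "R \<in> carrier G" "R \<otimes>\<^bsub>G\<^esub> R = Affine (w3\<^sup>2) (w3 * v3)"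
      using halve_of_square by blast
    then show ?thesis using w3(1) unfolding mult_G P0 by auto
  qed
qed

text \<open>The two square roots of the abscissa give values with \<open>X X' = 4 q\<close>. Passing
  from \<open>w\<close> to \<open>-w\<close> therefore exchanges the classes 1 and
  \<open>5 p\<close>, and the classes 10 and \<open>2 p\<close>. Points of the first pair are
  doubles; those of the second become doubles on adding P0.\<close>

lemma halve_of_square_abscissa:
  assumes P: "on_curve (- q) 0 (Affine (w\<^sup>2) y)" and "w \<noteq> 0"
  shows "\<exists>R\<in>carrier G. R \<otimes>\<^bsub>G\<^esub> R = Affine (w\<^sup>2) y \<or> R \<otimes>\<^bsub>G\<^esub> R = Affine (w\<^sup>2) y \<otimes>\<^bsub>G\<^esub> P0"
proof -
  define v where "v = y / w"
  have y: "y = w * v" using \<open>w \<noteq> 0\<close> by (simp add: v_def)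
  have v: "v\<^sup>2 = w ^ 4 - q" using curve_halves P \<open>w \<noteq> 0\<close> unfolding y by blast
  have y': "Affine (w\<^sup>2) y = Affine ((- w)\<^sup>2) (- w * - v)" and v': "(- v)\<^sup>2 = (- w) ^ 4 - q" using y v by auto
  define X X' where "X = 2 * (w\<^sup>2 + v)" and "X' = 2 * ((- w)\<^sup>2 + - v)"
  have "v\<^sup>2 < (w\<^sup>2)\<^sup>2" using v q_gt_0 by (simp flip: power_mult)
  then have "\<bar>v\<bar> < w\<^sup>2"
    using power2_less_imp_less[of "\<bar>v\<bar>" "w\<^sup>2"] by (metis power2_abs zero_le_power2)
  then have "X > 0" by (simp add: X_def abs_less_iff)
  have XX': "X * X' = 4 * q" using v unfolding X_def X'_def by algebra
  \<comment> \<open>This says that \<open>(X, 2 w X)\<close> lies on the isogenous curve.\<close>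
  have "X\<^sup>2 + 4 * q = 4 * w\<^sup>2 * X" using v unfolding X_def by algebra
  then have "(2 * w * X)\<^sup>2 = X * (X\<^sup>2 + 20 * of_int p)"
    unfolding q_def by (simp add: power2_eq_square algebra_simps)
  from isogenous_square_class[OF this \<open>X > 0\<close>] obtain t where
    "X = t\<^sup>2 \<or> X = 10 * t\<^sup>2 \<or> X = q * t\<^sup>2 \<or> X = 2 * of_int p * t\<^sup>2"
    unfolding q_def by blast
  then consider "X = t\<^sup>2" | "X = 10 * t\<^sup>2" | "X = q * t\<^sup>2" | "X = 2 * of_int p * t\<^sup>2" by blast
  then show ?thesis
  proof cases
    case 1
    then show ?thesis using halve_of_square[OF v] unfolding X_def y by blast
  next
    case 2
    then show ?thesis using halve_of_ten_times_square[OF v] unfolding X_def y by blast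
  next
    case 3
    then have "t \<noteq> 0" using \<open>X > 0\<close> by auto
    have "q * (t\<^sup>2 * X') = q * 4" using XX' unfolding 3 by (simp add: ac_simps)
    then have "t\<^sup>2 * X' = 4" using q_gt_0 by simp
    then have "X' = (2 / t)\<^sup>2" using \<open>t \<noteq> 0\<close> by (simp add: power_divide field_simps)
    then show ?thesis using halve_of_square[OF v'] unfolding X'_def y' by blast
  next
    case 4
    then have "t \<noteq> 0" using \<open>X > 0\<close> by auto
    have "(2 * of_int p) * (t\<^sup>2 * X') = (2 * of_int p) * 10" using XX' unfolding 4 q_def by (simp add: ac_simps)
    then have "t\<^sup>2 * X' = 10" using p_gt_0 by (simp add: mult.commute)
    then have "X' = 10 * (1 / t)\<^sup>2" using \<open>t \<noteq> 0\<close> by (simp add: power_divide field_simps)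
    then show ?thesis using halve_of_ten_times_square[OF v'] unfolding X'_def y' by blast
  qed
qed

text \<open>The explicit weak Mordell-Weil statement on which finite generation and the rank bound
  both rest. Adding T sends \<open>x\<close> to \<open>- q / x\<close> and so turns the class
  \<open>-5 p\<close> into a square.\<close>

lemma halve_up_to_coset:
  assumes P: "P \<in> carrier G"
  shows "\<exists>R\<in>carrier G. \<exists>c\<in>{\<one>\<^bsub>G\<^esub>, T, P0, T \<otimes>\<^bsub>G\<^esub> P0}. R \<otimes>\<^bsub>G\<^esub> R = P \<otimes>\<^bsub>G\<^esub> c"
proof (cases P)
  case Infinity
  then show ?thesis using G.one_closed G.l_one unfolding one_G by blast
next
  case (Affine x y)
  have c: "on_curve (- q) 0 (Affine x y)" using P Affine carrier_G by simp
  show ?thesis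
  proof (cases "x = 0")
    case True
    then have "P = T" using y_eq_0_iff[OF c] Affine by (simp add: T_def)
    moreover have "T \<otimes>\<^bsub>G\<^esub> T = \<one>\<^bsub>G\<^esub>" by (simp add: T_def mult_G one_G)
    ultimately show ?thesis using G.one_closed by (intro bexI[of _ "\<one>\<^bsub>G\<^esub>"] bexI[of _ T]) auto
  next
    case False
    have "y\<^sup>2 = x * (x\<^sup>2 - 5 * of_int p)" using c unfolding curve_eq by (simp add: q_def)
    from x_square_class[OF this False] obtain w where w: "x = w\<^sup>2 \<or> x = - q * w\<^sup>2" 
      unfolding q_def by auto
    then have "w \<noteq> 0" using False by auto
    from w show ?thesis
    proof
      assume x: "x = w\<^sup>2"
      have "P = P \<otimes>\<^bsub>G\<^esub> \<one>\<^bsub>G\<^esub>" using P by simp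
      then show ?thesis using halve_of_square_abscissa[of w y] c \<open>w \<noteq> 0\<close> Affine x by auto
    next
      assume x: "x = - q * w\<^sup>2"
      obtain y' where y': "P \<otimes>\<^bsub>G\<^esub> T = Affine ((1 / w)\<^sup>2) y'"
        using ec_add_two_torsion[OF c False] q_gt_0 unfolding Affine mult_G T_def x
        by (simp del: ec_add.simps add: power_divide)
      have "on_curve (- q) 0 (Affine ((1 / w)\<^sup>2) y')"
        using G.m_closed[OF P T_in] unfolding y' carrier_G .
      then have "\<exists>R\<in>carrier G. R \<otimes>\<^bsub>G\<^esub> R = P \<otimes>\<^bsub>G\<^esub> T \<or> R \<otimes>\<^bsub>G\<^esub> R = (P \<otimes>\<^bsub>G\<^esub> T) \<otimes>\<^bsub>G\<^esub> P0"
        unfolding y' by (rule halve_of_square_abscissa) (use \<open>w \<noteq> 0\<close> in auto)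
      then show ?thesis using G.m_assoc[OF P T_in P0_in] by auto
    qed
  qed
qed

end

section \<open>Heights\<close>

definition height :: "rat \<Rightarrow> int" where
  "height x = max \<bar>fst (quotient_of x)\<bar> (snd (quotient_of x))"

lemma height_ge_1: "height x \<ge> 1"
  using quotient_of_denom_pos'[of x] by (simp add: height_def)

lemma quotientE:
  obtains r s where "x = of_int r / of_int s" "s > 0" "coprime r s" "\<bar>r\<bar> \<le> height x" "s \<le> height x"
    "height x = max \<bar>r\<bar> s"
proof -
  obtain r s where q: "quotient_of x = (r, s)" by force
  show ?thesis
    using quotient_of_denom_pos[OF q] quotient_of_coprime[OF q] quotient_of_div[OF q] q
    by (intro that[of r s]) (auto simp: height_def)
qed

lemma fraction_multiple:
  assumes "(of_int n / of_int d :: rat) = of_int r / of_int s" "d \<noteq> 0" "s > 0" "coprime r s"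
  obtains k where "n = r * k" "d = s * k" "k \<noteq> 0"
proof -
  have "rat_of_int (n * s) = of_int (r * d)" using assms(1-3) by (simp add: field_simps)
  then have e: "n * s = r * d" by (simp only: of_int_eq_iff)
  then have "s dvd r * d" by (metis dvd_triv_right)
  then have "s dvd d" using assms(4) by (simp add: coprime_commute coprime_dvd_mult_right_iff)
  then obtain k where k: "d = s * k" by auto
  with e assms(3) have "n = r * k" by simp
  with k assms(2) show ?thesis by (intro that[of k]) auto
qed

lemma height_le_max:
  assumes "d \<noteq> 0"
  shows "height (of_int n / of_int d) \<le> max \<bar>n\<bar> \<bar>d\<bar>"
proof (rule quotientE[of "of_int n / of_int d"])
  fix r s assume rs: "(of_int n / of_int d :: rat) = of_int r / of_int s" "s > 0" "coprime r s"
    "height (of_int n / of_int d) = max \<bar>r\<bar> s"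
  from fraction_multiple[OF rs(1) assms rs(2,3)] obtain k where k: "n = r * k" "d = s * k" "k \<noteq> 0" .
  have "\<bar>r\<bar> * 1 \<le> \<bar>r\<bar> * \<bar>k\<bar>" "s * 1 \<le> s * \<bar>k\<bar>" using k(3) rs(2) by (intro mult_left_mono; simp)+
  then have "max \<bar>r\<bar> s \<le> max \<bar>n\<bar> \<bar>d\<bar>"
    unfolding k(1,2) using rs(2) by (intro max.mono) (simp_all add: abs_mult)
  then show ?thesis using rs(4) by simp
qed

text \<open>Reducing the fraction cancels a divisor of \<open>gcd n d\<close> from \<open>n\<close>,
  hence a factor of absolute value at most \<open>K\<close>.\<close>

lemma numerator_le_height:
  assumes "d \<noteq> 0" "gcd n d dvd K" "K > 0"
  shows "\<bar>n\<bar> \<le> K * height (of_int n / of_int d)"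
proof (rule quotientE[of "of_int n / of_int d"])
  fix r s assume rs: "(of_int n / of_int d :: rat) = of_int r / of_int s" "s > 0" "coprime r s"
    "\<bar>r\<bar> \<le> height (of_int n / of_int d)"
  from fraction_multiple[OF rs(1) assms(1) rs(2,3)] obtain k where k: "n = r * k" "d = s * k" "k \<noteq> 0" .
  have "k dvd gcd n d" using k by simp
  then have "k dvd K" using assms(2) dvd_trans by blast
  then have "\<bar>k\<bar> \<le> K" using assms(3) dvd_imp_le_int[of K k] by simp
  then have "\<bar>k\<bar> * \<bar>r\<bar> \<le> K * height (of_int n / of_int d)"
    using rs(4) by (intro mult_mono) (use assms(3) in auto)
  then show ?thesis by (simp add: k(1) abs_mult mult.commute)
qed

lemma finite_height_le: "finite {x. height x \<le> B}"
proof (rule finite_subset)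
  show "{x. height x \<le> B} \<subseteq> (\<lambda>(r, s). of_int r / of_int s) ` ({-B..B} \<times> {0..B})"
  proof
    fix x assume "x \<in> {x. height x \<le> B}"
    then show "x \<in> (\<lambda>(r, s). of_int r / of_int s) ` ({-B..B} \<times> {0..B})"
      by (rule_tac quotientE[of x]) (force simp: abs_le_iff)
  qed
qed auto

lemma gcd_square_dvd: "gcd (A\<^sup>2) D dvd (gcd A D)\<^sup>2" for A D :: int
proof -
  obtain u v where uv: "gcd A D = u * A + v * D" using bezout_int by metis
  have "(u * A + v * D)\<^sup>2 = u\<^sup>2 * A\<^sup>2 + D * (2 * u * v * A + v\<^sup>2 * D)" by algebra
  moreover have "gcd (A\<^sup>2) D dvd u\<^sup>2 * A\<^sup>2 + D * (2 * u * v * A + v\<^sup>2 * D)"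
    by (intro dvd_add dvd_mult2 dvd_mult) auto
  ultimately show ?thesis by (simp add: uv)
qed

text \<open>These are numerator and denominator of the abscissa of a double at
  \<open>x = r / s\<close>. A common divisor of \<open>A\<close> and \<open>D\<close> is prime to
  \<open>s\<close>; it divides \<open>4 r s A - D = 8 Q r s^3\<close> and then
  \<open>8 Q A - 8 Q r^2 = 8 Q^2 s^2\<close>, hence \<open>8 Q^2\<close>.\<close>

lemma duplication_gcd_dvd:
  fixes r s Q :: int
  assumes cop: "coprime r s"
  shows "gcd ((r\<^sup>2 + Q * s\<^sup>2)\<^sup>2) (4 * r * s * (r\<^sup>2 - Q * s\<^sup>2)) dvd (8 * Q\<^sup>2)\<^sup>2"
proof -
  define A D e where "A = r\<^sup>2 + Q * s\<^sup>2" and "D = 4 * r * s * (r\<^sup>2 - Q * s\<^sup>2)" and "e = gcd A D"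
  have eA: "e dvd A" and eD: "e dvd D" by (auto simp: e_def)
  have es: "coprime e s"
  proof (rule coprimeI)
    fix c assume c: "c dvd e" "c dvd s"
    then have "c dvd A - Q * s\<^sup>2" using eA by (intro dvd_diff) (auto simp: power2_eq_square intro: dvd_trans)
    then have "c dvd r\<^sup>2" by (simp add: A_def)
    moreover have "coprime (r\<^sup>2) s" using cop by simp
    ultimately show "is_unit c" using c(2) coprime_common_divisor by blast
  qed
  have "4 * r * s * A - D = (8 * Q * r) * s ^ 3" unfolding A_def D_def by algebra
  then have "e dvd (8 * Q * r) * s ^ 3" using eA eD by (metis dvd_diff dvd_mult)
  then have "e dvd 8 * Q * r" using es by (simp add: coprime_dvd_mult_left_iff)
  then have "e dvd 8 * Q * A - (8 * Q * r) * r" using eA by (blast intro: dvd_diff dvd_mult dvd_mult2)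
  also have "8 * Q * A - (8 * Q * r) * r = 8 * Q\<^sup>2 * s\<^sup>2" unfolding A_def by algebra
  finally have "e dvd 8 * Q\<^sup>2" using es by (simp add: coprime_dvd_mult_left_iff)
  then have "e\<^sup>2 dvd (8 * Q\<^sup>2)\<^sup>2" by (rule dvd_power_same)
  moreover have "gcd (A\<^sup>2) D dvd e\<^sup>2" unfolding e_def by (rule gcd_square_dvd)
  ultimately show ?thesis unfolding A_def D_def using dvd_trans by blast
qed

text \<open>The value 1 at \<open>Infinity\<close> is the least possible height, so that
  \<open>h \<le> h^2\<close> holds for every point.\<close>

fun point_height :: "rat point \<Rightarrow> int" where
  "point_height Infinity = 1"
| "point_height (Affine x y) = height x"

lemma point_height_ge_1: "point_height P \<ge> 1"
  by (cases P) (simp_all add: height_ge_1)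

lemma finite_point_height_le:
  "finite {P. on_curve a b P \<and> point_height P \<le> B}"
proof (rule finite_subset)
  let ?Y = "\<lambda>x. {y. y\<^sup>2 = x ^ 3 + a * x + b}"
  show "{P. on_curve a b P \<and> point_height P \<le> B} \<subseteq>
      insert Infinity (\<Union>x\<in>{x. height x \<le> B}. Affine x ` ?Y x)"
  proof
    fix P assume "P \<in> {P. on_curve a b P \<and> point_height P \<le> B}"
    then show "P \<in> insert Infinity (\<Union>x\<in>{x. height x \<le> B}. Affine x ` ?Y x)" by (cases P) auto
  qed
  have "finite {y. y\<^sup>2 = c}" for c :: rat
  proof (cases "\<exists>z. z\<^sup>2 = c")
    case True
    then obtain z where "z\<^sup>2 = c" by blast
    then have "{y. y\<^sup>2 = c} \<subseteq> {z, - z}" by (auto simp: power2_eq_iff)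
    then show ?thesis by (rule finite_subset) simp
  qed simp
  then show "finite (insert Infinity (\<Union>x\<in>{x. height x \<le> B}. Affine x ` ?Y x))"
    using finite_height_le by blast
qed

text \<open>Because the coefficient \<open>-Q\<close> is negative, the numerator
  \<open>(r^2 + Q s^2)^2\<close> alone dominates the fourth power of the height, and cancellation
  costs at most the factor \<open>(8 Q^2)^2\<close>.\<close>

lemma height_double:
  fixes Q :: int and x y :: rat
  assumes Q: "Q > 0" and curve: "on_curve (- of_int Q) 0 (Affine x y)" and "y \<noteq> 0"
  shows "height x ^ 4 \<le> (8 * Q\<^sup>2)\<^sup>2 * height (((x\<^sup>2 + of_int Q) / (2 * y))\<^sup>2)"
proof (rule quotientE[of x])
  fix r s assume rs: "x = of_int r / of_int s" "s > 0" "coprime r s" "height x = max \<bar>r\<bar> s"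
  define n where "n = (r\<^sup>2 + Q * s\<^sup>2)\<^sup>2"
  define d where "d = 4 * r * s * (r\<^sup>2 - Q * s\<^sup>2)"
  have y2: "y\<^sup>2 = x * (x\<^sup>2 - of_int Q)" using curve by (simp add: algebra_simps power2_eq_square power3_eq_cube)
  have "of_int d = 4 * y\<^sup>2 * of_int s ^ 4"
    unfolding y2 rs(1) d_def using rs(2) by (simp add: field_simps power2_eq_square power4_eq_xxxx)
  moreover have "of_int n = (x\<^sup>2 + of_int Q)\<^sup>2 * of_int s ^ 4"
    unfolding rs(1) n_def using rs(2) by (simp add: field_simps power2_eq_square power4_eq_xxxx)
  ultimately have e: "((x\<^sup>2 + of_int Q) / (2 * y))\<^sup>2 = of_int n / of_int d"
    using rs(2) by (simp add: power_divide power_mult_distrib)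
  have "d \<noteq> 0" using \<open>of_int d = 4 * y\<^sup>2 * of_int s ^ 4\<close> \<open>y \<noteq> 0\<close> rs(2) by auto
  have "n \<le> (8 * Q\<^sup>2)\<^sup>2 * height (of_int n / of_int d)"
    using numerator_le_height[OF \<open>d \<noteq> 0\<close> duplication_gcd_dvd[OF rs(3), of Q, folded n_def d_def]] Q by simp
  moreover have "height x ^ 4 \<le> n"
  proof -
    have "Q * s\<^sup>2 \<ge> 1 * s\<^sup>2" using Q by (intro mult_right_mono) auto
    then have "r\<^sup>2 \<le> r\<^sup>2 + Q * s\<^sup>2" "s\<^sup>2 \<le> r\<^sup>2 + Q * s\<^sup>2" using zero_le_power2[of s] zero_le_power2[of r] by linarith+
    then have "(height x)\<^sup>2 \<le> r\<^sup>2 + Q * s\<^sup>2" unfolding rs(4) by (auto simp: max_def)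
    then have "((height x)\<^sup>2)\<^sup>2 \<le> n" unfolding n_def by (intro power_mono) auto
    then show ?thesis by (simp flip: power_mult)
  qed
  ultimately show ?thesis unfolding e by linarith
qed

lemma height_two_torsion_translate:
  fixes Q :: int
  assumes "Q > 0" "x \<noteq> 0"
  shows "height (- of_int Q / x) \<le> Q * height x"
proof (rule quotientE[of x])
  fix r s assume rs: "x = of_int r / of_int s" "s > 0" "\<bar>r\<bar> \<le> height x" "s \<le> height x"
  have "r \<noteq> 0" using rs(1) assms(2) by auto
  have "- of_int Q / x = of_int (- Q * s) / of_int r" unfolding rs(1) by simp
  then have "height (- of_int Q / x) \<le> max \<bar>- Q * s\<bar> \<bar>r\<bar>"
    using height_le_max[OF \<open>r \<noteq> 0\<close>] by metis
  moreover have "\<bar>- Q * s\<bar> \<le> Q * height x" using assms(1) rs by (simp add: abs_mult)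
  moreover have "\<bar>r\<bar> \<le> Q * height x"
    using mult_mono[of 1 Q "\<bar>r\<bar>" "height x"] assms(1) rs(3) by simp
  ultimately show ?thesis by simp
qed

text \<open>The addition formula looks cubic in \<open>x\<close>. The two curve equations cancel the
  leading terms and leave the numerator \<open>(x + e) (x e - Q) - 2 y f\<close>; after clearing
  \<open>s^2\<close> it is quadratic in the height, since \<open>u = y s^2\<close> is an integer of
  size at most \<open>(1 + Q) H^2\<close>. The constant bounds numerator and denominator at
  once.\<close>

lemma height_translate:
  fixes Q e f :: int and x y :: rat
  assumes Q: "Q > 0" and c: "on_curve (- of_int Q) 0 (Affine x y)"
    "on_curve (- of_int Q) 0 (Affine (of_int e) (of_int f :: rat))" and ne: "x \<noteq> of_int e"
  shows "height (((of_int f - y) / (of_int e - x))\<^sup>2 - x - of_int e)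
    \<le> ((1 + \<bar>e\<bar>) * (1 + \<bar>e\<bar> + Q) + 2 * \<bar>f\<bar> * (1 + Q)) * (height x)\<^sup>2"
proof (rule quotientE[of x])
  fix r s assume rs: "x = of_int r / of_int s" "s > 0" "coprime r s" "\<bar>r\<bar> \<le> height x" "s \<le> height x"
  define H where "H = height x"
  have H: "H \<ge> 1" "\<bar>r\<bar> \<le> H" "s \<le> H" using rs height_ge_1 by (auto simp: H_def)
  have y2: "y\<^sup>2 = x * (x\<^sup>2 - of_int Q)" and f2: "(of_int f)\<^sup>2 = rat_of_int e * ((of_int e)\<^sup>2 - of_int Q)"
    using c by (simp_all add: algebra_simps power2_eq_square power3_eq_cube)
  have "(y * of_int s ^ 2)\<^sup>2 = y\<^sup>2 * of_int s ^ 4" by (simp add: power_mult_distrib flip: power_mult)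
  also have "\<dots> = of_int (r * s * (r\<^sup>2 - Q * s\<^sup>2))"
    unfolding y2 rs(1) using rs(2) by (simp add: field_simps power2_eq_square power4_eq_xxxx)
  finally have *: "(y * of_int s ^ 2)\<^sup>2 = of_int (r * s * (r\<^sup>2 - Q * s\<^sup>2))" .
  then obtain u where u: "y * of_int s ^ 2 = of_int u" by (rule rat_power2_eq_of_int)
  with * have u2: "u\<^sup>2 = r * s * (r\<^sup>2 - Q * s\<^sup>2)" by (metis of_int_eq_iff of_int_power)
  have r2: "r\<^sup>2 \<le> H\<^sup>2" and s2: "s\<^sup>2 \<le> H\<^sup>2"
    using power_mono[of "\<bar>r\<bar>" H 2] power_mono[of s H 2] H rs(2) by auto
  have "\<bar>u\<bar> \<le> (1 + Q) * H\<^sup>2"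
  proof (rule power2_le_imp_le)
    have "\<bar>r * s\<bar> \<le> H * H" unfolding abs_mult using H rs(2) by (intro mult_mono) auto
    moreover have "\<bar>r\<^sup>2 - Q * s\<^sup>2\<bar> \<le> H\<^sup>2 + Q * H\<^sup>2"
    proof -
      have "Q * s\<^sup>2 \<le> Q * H\<^sup>2" "0 \<le> Q * s\<^sup>2" using s2 Q by auto
      then show ?thesis using r2 zero_le_power2[of r] by linarith
    qed
    ultimately have "\<bar>r * s\<bar> * \<bar>r\<^sup>2 - Q * s\<^sup>2\<bar> \<le> (H * H) * (H\<^sup>2 + Q * H\<^sup>2)"
      using H by (intro mult_mono) auto
    then have "u\<^sup>2 \<le> (H * H) * (H\<^sup>2 + Q * H\<^sup>2)" unfolding u2 by (simp only: flip: abs_mult)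
    also have "\<dots> = (1 + Q) * H\<^sup>2 * H\<^sup>2" by (simp add: power2_eq_square algebra_simps)
    also have "\<dots> \<le> (1 + Q) * ((1 + Q) * H\<^sup>2 * H\<^sup>2)"
      using Q mult_right_mono[of 1 "1 + Q" "(1 + Q) * H\<^sup>2 * H\<^sup>2"] by simp
    also have "\<dots> = ((1 + Q) * H\<^sup>2)\<^sup>2" by (simp add: power2_eq_square algebra_simps)
    finally show "\<bar>u\<bar>\<^sup>2 \<le> ((1 + Q) * H\<^sup>2)\<^sup>2" by simp
  qed (use Q in simp)
  define n where "n = (r + e * s) * (r * e - Q * s) - 2 * u * f"
  define d where "d = (r - e * s)\<^sup>2"
  have "(((of_int f - y) / (of_int e - x))\<^sup>2 - x - of_int e) * (of_int e - x)\<^sup>2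
      = (of_int f - y)\<^sup>2 - (x + of_int e) * (of_int e - x)\<^sup>2"
    using ne by (simp add: power_divide algebra_simps)
  also have "\<dots> = (x + of_int e) * (x * of_int e - of_int Q) - 2 * y * of_int f"
    using y2 f2 by algebra
  finally have "(((of_int f - y) / (of_int e - x))\<^sup>2 - x - of_int e) * ((of_int e - x)\<^sup>2 * of_int s ^ 2)
      = ((x + of_int e) * (x * of_int e - of_int Q) - 2 * y * of_int f) * of_int s ^ 2" by (metis mult.assoc)
  also have "\<dots> = of_int n"
    using rs(2) u unfolding n_def rs(1) by (simp add: field_simps power2_eq_square)
  also have d: "(of_int e - x)\<^sup>2 * of_int s ^ 2 = of_int d"
    using rs(2) unfolding d_def rs(1) by (simp add: field_simps power2_eq_square)
  finally have "(((of_int f - y) / (of_int e - x))\<^sup>2 - x - of_int e) * of_int d = of_int n" .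
  moreover have "d \<noteq> 0" using d ne rs(2) by auto
  ultimately have X: "((of_int f - y) / (of_int e - x))\<^sup>2 - x - of_int e = of_int n / of_int d"
    by (simp add: eq_divide_eq)
  define E where "E = \<bar>e\<bar>"
  have eH: "\<bar>e * s\<bar> \<le> E * H" "\<bar>r * e\<bar> \<le> E * H" "\<bar>Q * s\<bar> \<le> Q * H"
    using H rs(2) Q unfolding abs_mult E_def by (auto intro: mult_left_mono simp: mult.commute[of "\<bar>r\<bar>"])
  have a1: "\<bar>r + e * s\<bar> \<le> (1 + E) * H" "\<bar>r - e * s\<bar> \<le> (1 + E) * H" "\<bar>r * e - Q * s\<bar> \<le> (E + Q) * H"
    using eH H(2) by (simp_all add: algebra_simps)
  have "\<bar>(r + e * s) * (r * e - Q * s)\<bar> \<le> ((1 + E) * H) * ((E + Q) * H)"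
    unfolding abs_mult by (rule mult_mono[OF a1(1,3)]) (use H E_def in auto)
  moreover have "((1 + E) * H) * ((E + Q) * H) + (1 + E) * H\<^sup>2 = (1 + E) * (1 + E + Q) * H\<^sup>2"
    by (simp add: power2_eq_square algebra_simps)
  moreover have "0 \<le> (1 + E) * H\<^sup>2" by (simp add: E_def)
  moreover have "\<bar>2 * u * f\<bar> \<le> 2 * \<bar>f\<bar> * ((1 + Q) * H\<^sup>2)"
    using mult_left_mono[OF \<open>\<bar>u\<bar> \<le> (1 + Q) * H\<^sup>2\<close>, of "2 * \<bar>f\<bar>"] by (simp add: abs_mult ac_simps)
  ultimately have n: "\<bar>n\<bar> \<le> (1 + E) * (1 + E + Q) * H\<^sup>2 + 2 * \<bar>f\<bar> * ((1 + Q) * H\<^sup>2)"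
    unfolding n_def by linarith
  have "\<bar>r - e * s\<bar> * \<bar>r - e * s\<bar> \<le> ((1 + E) * H) * ((1 + E) * H)"
    by (rule mult_mono[OF a1(2,2)]) (use H E_def in auto)
  then have "d \<le> (1 + E) * (1 + E) * H\<^sup>2" unfolding d_def by (simp add: power2_eq_square ac_simps)
  moreover have "(1 + E) * (1 + E) * H\<^sup>2 \<le> (1 + E) * (1 + E + Q) * H\<^sup>2"
    using Q by (intro mult_right_mono mult_left_mono) (auto simp: E_def)
  moreover have "0 \<le> 2 * \<bar>f\<bar> * ((1 + Q) * H\<^sup>2)" using Q by simp
  ultimately have "\<bar>d\<bar> \<le> (1 + E) * (1 + E + Q) * H\<^sup>2 + 2 * \<bar>f\<bar> * ((1 + Q) * H\<^sup>2)"
    unfolding d_def by simp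
  with n have "max \<bar>n\<bar> \<bar>d\<bar> \<le> ((1 + E) * (1 + E + Q) + 2 * \<bar>f\<bar> * (1 + Q)) * H\<^sup>2"
    by (simp add: algebra_simps)
  then show ?thesis using height_le_max[OF \<open>d \<noteq> 0\<close>, of n] unfolding X E_def H_def by linarith
qed

section \<open>Heights on the curve, finite generation and the rank\<close>

context special_prime
begin

lemma q_eq_of_int: "q = of_int (5 * p)"
  by (simp add: q_def)

lemma height_add_T:
  assumes "P \<in> carrier G"
  shows "point_height (P \<otimes>\<^bsub>G\<^esub> T) \<le> 5 * p * point_height P"
proof -
  have "5 * p \<ge> 1" using p_gt_0 by simp
  have "height 0 = 1" by (simp add: height_def)
  show ?thesis
  proof (cases P)
    case Infinity
    then show ?thesis using \<open>5 * p \<ge> 1\<close> \<open>height 0 = 1\<close> by (simp add: mult_G T_def)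
  next
    case (Affine x y)
    have c: "on_curve (- q) 0 (Affine x y)" using assms unfolding Affine carrier_G .
    show ?thesis
    proof (cases "x = 0")
      case True
      then have "y = 0" using y_eq_0_iff[OF c] by simp
      then show ?thesis using \<open>5 * p \<ge> 1\<close> \<open>height 0 = 1\<close> True unfolding Affine by (simp add: mult_G T_def)
    next
      case False
      then show ?thesis using height_two_torsion_translate[of "5 * p" x] p_gt_0
        unfolding Affine mult_G T_def ec_add_two_torsion[OF c False] point_height.simps
        unfolding q_eq_of_int by simp
    qed
  qed
qed

lemma height_add_P0:
  obtains C where "C > 0" "\<And>P. P \<in> carrier G \<Longrightarrow> point_height (P \<otimes>\<^bsub>G\<^esub> P0) \<le> C * (point_height P)\<^sup>2"
proof -
  define e f where "e = 4 * m ^ 2" and "f = 2 * m * (4 * m ^ 2 - 5)"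
  have P0: "P0 = Affine (of_int e) (of_int f)" by (simp add: P0_def e_def f_def)
  define C0 where "C0 = (1 + \<bar>e\<bar>) * (1 + \<bar>e\<bar> + 5 * p) + 2 * \<bar>f\<bar> * (1 + 5 * p)"
  \<comment> \<open>The chord bound \<open>C0\<close> does not apply to the identity and to the
    points sharing the abscissa of P0; the maximum covers their sums with P0.\<close>
  define C where "C = max C0 (max (point_height P0) (point_height (P0 \<otimes>\<^bsub>G\<^esub> P0)))"
  have C: "C \<ge> 1" "C \<ge> point_height P0" "C \<ge> point_height (P0 \<otimes>\<^bsub>G\<^esub> P0)" "C \<ge> C0"
    using point_height_ge_1[of P0] by (auto simp: C_def)
  have sq: "C \<le> C * (point_height P)\<^sup>2" for P
    using mult_left_mono[of 1 "(point_height P)\<^sup>2" C] C(1) point_height_ge_1[of P]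
    by (simp add: one_le_power)
  have "point_height (P \<otimes>\<^bsub>G\<^esub> P0) \<le> C * (point_height P)\<^sup>2" if P: "P \<in> carrier G" for P
  proof (cases P)
    case Infinity
    then show ?thesis using C(2) sq[of P] by (simp add: mult_G)
  next
    case (Affine x y)
    have c: "on_curve (- q) 0 (Affine x y)" using P unfolding Affine carrier_G .
    have c0: "on_curve (- q) 0 (Affine (of_int e) (of_int f))" using P0_in unfolding P0 carrier_G .
    show ?thesis
    proof (cases "x = of_int e")
      case True
      then have "y\<^sup>2 = (of_int f)\<^sup>2" using c c0 by simp
      then have "y = of_int f \<or> y = - of_int f" by (simp add: power2_eq_iff)
      then have "P = P0 \<or> P \<otimes>\<^bsub>G\<^esub> P0 = Infinity"
        unfolding Affine P0 mult_G using True by auto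
      then have "point_height (P \<otimes>\<^bsub>G\<^esub> P0) \<le> C" using C by auto
      then show ?thesis using sq[of P] by linarith
    next
      case False
      have "point_height (P \<otimes>\<^bsub>G\<^esub> P0) \<le> C0 * (height x)\<^sup>2"
        using height_translate[of "5 * p" x y e f] c c0 p_gt_0 False
        unfolding Affine P0 mult_G C0_def q_eq_of_int by (simp add: Let_def del: on_curve.simps)
      also have "\<dots> \<le> C * (height x)\<^sup>2" using C(4) by (intro mult_right_mono) auto
      finally show ?thesis by (simp add: Affine)
    qed
  qed
  then show ?thesis using that[of C] C(1) by simp
qed

lemma height_double_point:
  assumes "R \<in> carrier G"
  shows "point_height R ^ 4 \<le> (8 * (5 * p)\<^sup>2)\<^sup>2 * point_height (R \<otimes>\<^bsub>G\<^esub> R)"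
proof -
  have "1 \<le> (5 * p)\<^sup>2" using p_gt_0 by (intro one_le_power) simp
  then have "1 \<le> (8 * (5 * p)\<^sup>2)\<^sup>2" by (intro one_le_power) linarith
  then have K: "1 \<le> (8 * (5 * p)\<^sup>2)\<^sup>2 * point_height S" for S
    using mult_mono[of 1 "(8 * (5 * p)\<^sup>2)\<^sup>2" 1 "point_height S"] point_height_ge_1[of S] by simp
  show ?thesis
  proof (cases R)
    case Infinity
    then show ?thesis using K[of Infinity] by (simp add: mult_G)
  next
    case (Affine x y)
    have c: "on_curve (- q) 0 (Affine x y)" using assms unfolding Affine carrier_G .
    show ?thesis
    proof (cases "y = 0")
      case True
      then have "x = 0" using y_eq_0_iff[OF c] by simp
      then have "point_height R = 1" by (simp add: Affine height_def)
      then show ?thesis using K by simp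
    next
      case False
      from ec_doubleE[OF rat_two c False] obtain w v where
        w: "ec_add (- q) (Affine x y) (Affine x y) = Affine (w\<^sup>2) (w * v)" "w = (x\<^sup>2 - - q) / (2 * y)"
        by metis
      have "point_height (R \<otimes>\<^bsub>G\<^esub> R) = height (((x\<^sup>2 + of_int (5 * p)) / (2 * y))\<^sup>2)"
        unfolding Affine mult_G w(1) point_height.simps w(2) unfolding q_eq_of_int by simp
      then show ?thesis using height_double[of "5 * p" x y] c False p_gt_0
        unfolding Affine q_eq_of_int by (simp del: on_curve.simps)
    qed
  qed
qed

text \<open>The exponents 4 and 2 drive the descent: up to constants, doubling raises the height at
  least to the fourth power, while translation by a coset representative at most squares it.\<close>

lemma halve_height:
  obtains K where "\<And>P. P \<in> carrier G \<Longrightarrow>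
    \<exists>R\<in>carrier G. \<exists>c\<in>{\<one>\<^bsub>G\<^esub>, T, P0, T \<otimes>\<^bsub>G\<^esub> P0}. R \<otimes>\<^bsub>G\<^esub> R = P \<otimes>\<^bsub>G\<^esub> c \<and>
      point_height R ^ 4 \<le> K * (point_height P)\<^sup>2"
proof -
  obtain C where C: "C > 0" "\<And>P. P \<in> carrier G \<Longrightarrow> point_height (P \<otimes>\<^bsub>G\<^esub> P0) \<le> C * (point_height P)\<^sup>2"
    by (rule height_add_P0) blast
  define q' where "q' = 5 * p"
  have q': "q' \<ge> 1" using p_gt_0 by (simp add: q'_def)
  \<comment> \<open>One summand for each of 0, T, P0 and T + P0.\<close>
  define L where "L = 1 + q' + C + C * q'\<^sup>2"
  have bound: "point_height (P \<otimes>\<^bsub>G\<^esub> c) \<le> L * (point_height P)\<^sup>2"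
    if P: "P \<in> carrier G" and c: "c \<in> {\<one>\<^bsub>G\<^esub>, T, P0, T \<otimes>\<^bsub>G\<^esub> P0}" for P c
  proof -
    define h where "h = point_height P"
    have h: "h \<ge> 1" "h \<le> h\<^sup>2" using point_height_ge_1 self_le_power[of h 2] by (auto simp: h_def)
    have PT: "point_height (P \<otimes>\<^bsub>G\<^esub> T) \<le> q' * h" using height_add_T[OF P] by (simp add: h_def q'_def)
    have pos: "0 \<le> h\<^sup>2" "0 \<le> q' * h\<^sup>2" "0 \<le> C * h\<^sup>2" "0 \<le> C * q'\<^sup>2 * h\<^sup>2" using q' C by auto
    have L: "L * h\<^sup>2 = h\<^sup>2 + q' * h\<^sup>2 + C * h\<^sup>2 + C * q'\<^sup>2 * h\<^sup>2" by (simp add: L_def algebra_simps)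
    have "point_height ((P \<otimes>\<^bsub>G\<^esub> T) \<otimes>\<^bsub>G\<^esub> P0) \<le> C * (q' * h)\<^sup>2"
    proof -
      have "(point_height (P \<otimes>\<^bsub>G\<^esub> T))\<^sup>2 \<le> (q' * h)\<^sup>2"
        using PT point_height_ge_1[of "P \<otimes>\<^bsub>G\<^esub> T"] by (intro power_mono) auto
      then show ?thesis using C(2)[OF G.m_closed[OF P T_in]] C(1)
        by (meson mult_left_mono order.trans less_imp_le)
    qed
    moreover have "q' * h \<le> q' * h\<^sup>2" using q' h by (intro mult_left_mono) auto
    ultimately show ?thesis
      using c PT C(2)[OF P] pos h G.m_assoc[OF P T_in P0_in] P unfolding L h_def[symmetric]
      by (auto simp: h_def[symmetric] power_mult_distrib)
  qed
  define K where "K = (8 * q'\<^sup>2)\<^sup>2 * L"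
  have "\<exists>R\<in>carrier G. \<exists>c\<in>{\<one>\<^bsub>G\<^esub>, T, P0, T \<otimes>\<^bsub>G\<^esub> P0}. R \<otimes>\<^bsub>G\<^esub> R = P \<otimes>\<^bsub>G\<^esub> c \<and>
      point_height R ^ 4 \<le> K * (point_height P)\<^sup>2" if P: "P \<in> carrier G" for P
  proof -
    obtain R c where R: "R \<in> carrier G" "c \<in> {\<one>\<^bsub>G\<^esub>, T, P0, T \<otimes>\<^bsub>G\<^esub> P0}" "R \<otimes>\<^bsub>G\<^esub> R = P \<otimes>\<^bsub>G\<^esub> c"
      using halve_up_to_coset[OF P] by blast
    have "point_height R ^ 4 \<le> (8 * q'\<^sup>2)\<^sup>2 * point_height (P \<otimes>\<^bsub>G\<^esub> c)"
      using height_double_point[OF R(1)] unfolding R(3) q'_def .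
    also have "\<dots> \<le> (8 * q'\<^sup>2)\<^sup>2 * (L * (point_height P)\<^sup>2)"
      using bound[OF P R(2)] by (intro mult_left_mono) auto
    finally show ?thesis using R unfolding K_def by (metis mult.assoc)
  qed
  then show ?thesis by (rule that)
qed

lemma cosets_in: "c \<in> {\<one>\<^bsub>G\<^esub>, T, P0, T \<otimes>\<^bsub>G\<^esub> P0} \<Longrightarrow> c \<in> carrier G"
  using T_in P0_in by auto

lemma eq_double_mult_inv:
  assumes "P \<in> carrier G" "R \<in> carrier G" "c \<in> carrier G" "R \<otimes>\<^bsub>G\<^esub> R = P \<otimes>\<^bsub>G\<^esub> c"
  shows "P = (R \<otimes>\<^bsub>G\<^esub> R) \<otimes>\<^bsub>G\<^esub> inv\<^bsub>G\<^esub> c"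
  using assms by (simp add: G.m_assoc)

lemma finitely_generated: "finitely_generated_group G"
proof -
  obtain K where K: "\<And>P. P \<in> carrier G \<Longrightarrow>
    \<exists>R\<in>carrier G. \<exists>c\<in>{\<one>\<^bsub>G\<^esub>, T, P0, T \<otimes>\<^bsub>G\<^esub> P0}. R \<otimes>\<^bsub>G\<^esub> R = P \<otimes>\<^bsub>G\<^esub> c \<and>
      point_height R ^ 4 \<le> K * (point_height P)\<^sup>2" by (rule halve_height) blast
  show ?thesis
  proof (rule G.finitely_generated_by_descent[where h = "\<lambda>P. nat (point_height P)"
        and C = "(\<lambda>c. inv\<^bsub>G\<^esub> c) ` {\<one>\<^bsub>G\<^esub>, T, P0, T \<otimes>\<^bsub>G\<^esub> P0}" and B = "nat K"])
    show "(\<lambda>c. inv\<^bsub>G\<^esub> c) ` {\<one>\<^bsub>G\<^esub>, T, P0, T \<otimes>\<^bsub>G\<^esub> P0} \<subseteq> carrier G"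
      using cosets_in by blast
    have "{x \<in> carrier G. nat (point_height x) \<le> nat K} \<subseteq> {P. on_curve (- q) 0 P \<and> point_height P \<le> max K 0}"
      by (auto simp: carrier_G)
    then show "finite {x \<in> carrier G. nat (point_height x) \<le> nat K}"
      by (rule finite_subset) (rule finite_point_height_le)
    fix P assume P: "P \<in> carrier G" and big: "nat K < nat (point_height P)"
    obtain R c where R: "R \<in> carrier G" "c \<in> {\<one>\<^bsub>G\<^esub>, T, P0, T \<otimes>\<^bsub>G\<^esub> P0}" "R \<otimes>\<^bsub>G\<^esub> R = P \<otimes>\<^bsub>G\<^esub> c"
      "point_height R ^ 4 \<le> K * (point_height P)\<^sup>2" using K[OF P] by blast
    define h where "h = point_height P"
    have h: "h \<ge> 1" "K < h" using point_height_ge_1 big by (auto simp: h_def)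
    \<comment> \<open>The threshold \<open>K\<close> suffices: \<open>h > K\<close> gives
      \<open>K h^2 < h^3 \<le> h^4\<close>.\<close>
    have "K * h\<^sup>2 < h * h\<^sup>2" using h by (intro mult_strict_right_mono) auto
    also have "\<dots> = h ^ 3" by (simp add: power3_eq_cube power2_eq_square)
    also have "\<dots> \<le> h ^ 4" using h(1) by (intro power_increasing) auto
    finally have "point_height R ^ 4 < h ^ 4" using R(4) by (simp add: h_def)
    then have "point_height R < h" using h(1) by (simp add: power_less_imp_less_base)
    then have "nat (point_height R) < nat (point_height P)"
      using point_height_ge_1[of R] by (simp add: h_def)
    with R eq_double_mult_inv[OF P R(1) cosets_in[OF R(2)] R(3)]
    show "\<exists>r\<in>carrier G. \<exists>c\<in>(\<lambda>c. inv\<^bsub>G\<^esub> c) ` {\<one>\<^bsub>G\<^esub>, T, P0, T \<otimes>\<^bsub>G\<^esub> P0}.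
        P = (r \<otimes>\<^bsub>G\<^esub> r) \<otimes>\<^bsub>G\<^esub> c \<and> nat (point_height r) < nat (point_height P)"
      by blast
  qed simp
qed

lemma rank_1: "has_rank G 1"
proof (rule G.has_rank_1[OF finitely_generated P0_in P0_infinite_order])
  \<comment> \<open>\<open>N\<close> contains P0 and the torsion point T, hence all four coset
    representatives, so halving expresses every point as a double plus an element of
    \<open>N\<close>.\<close>
  define N where "N = {x \<in> carrier G. \<exists>n::nat. n > 0 \<and> (\<exists>i::int. x [^]\<^bsub>G\<^esub> n = P0 [^]\<^bsub>G\<^esub> i)}"
  have N: "subgroup N G" unfolding N_def by (rule G.subgroup_commensurable[OF P0_in])
  have "P0 [^]\<^bsub>G\<^esub> (1::nat) = P0 [^]\<^bsub>G\<^esub> (1::int)" using P0_in by simp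
  then have "P0 \<in> N" using P0_in unfolding N_def by blast
  have "T \<otimes>\<^bsub>G\<^esub> T = \<one>\<^bsub>G\<^esub>" by (simp add: T_def mult_G one_G)
  then have "T [^]\<^bsub>G\<^esub> (2::nat) = P0 [^]\<^bsub>G\<^esub> (0::int)" using T_in by (simp add: numeral_2_eq_2)
  then have "T \<in> N" using T_in pos2 unfolding N_def by blast
  have cosets_N: "c \<in> N" if "c \<in> {\<one>\<^bsub>G\<^esub>, T, P0, T \<otimes>\<^bsub>G\<^esub> P0}" for c
    using that \<open>T \<in> N\<close> \<open>P0 \<in> N\<close> subgroup.one_closed[OF N] subgroup.m_closed[OF N] by auto
  obtain S where S: "finite S" "S \<subseteq> carrier G" "generate G S = carrier G"
    using finitely_generated unfolding finitely_generated_group_def by blast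
  have "\<exists>d::int. odd d \<and> (\<forall>x\<in>carrier G. x [^]\<^bsub>G\<^esub> d \<in> N)"
  proof (rule G.odd_power_into_subgroup[OF N S(1,2) G.subgroup_self])
    show "N \<subseteq> carrier G" using N subgroup.subset by blast
    show "carrier G \<subseteq> generate G (N \<union> S)"
      using G.mono_generate[of S "N \<union> S"] S(3) by auto
    show "\<exists>y\<in>carrier G. \<exists>n\<in>N. P = (y \<otimes>\<^bsub>G\<^esub> y) \<otimes>\<^bsub>G\<^esub> n" if P: "P \<in> carrier G" for P
    proof -
      obtain R c where R: "R \<in> carrier G" "c \<in> {\<one>\<^bsub>G\<^esub>, T, P0, T \<otimes>\<^bsub>G\<^esub> P0}" "R \<otimes>\<^bsub>G\<^esub> R = P \<otimes>\<^bsub>G\<^esub> c"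
        using halve_up_to_coset[OF P] by blast
      then show ?thesis
        using eq_double_mult_inv[OF P R(1) cosets_in[OF R(2)] R(3)]
          subgroup.m_inv_closed[OF N cosets_N[OF R(2)]] by blast
    qed
  qed (fact S(2))
  then obtain d :: int where d: "odd d" "\<And>x. x \<in> carrier G \<Longrightarrow> x [^]\<^bsub>G\<^esub> d \<in> N" by blast
  fix x assume x: "x \<in> carrier G"
  obtain n :: nat and i :: int where n: "n > 0" "(x [^]\<^bsub>G\<^esub> d) [^]\<^bsub>G\<^esub> n = P0 [^]\<^bsub>G\<^esub> i"
    using d(2)[OF x] unfolding N_def by auto
  then have e: "x [^]\<^bsub>G\<^esub> (d * int n) = P0 [^]\<^bsub>G\<^esub> i"
    using x by (simp add: G.int_pow_pow flip: int_pow_int)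
  have "d \<noteq> 0" using d(1) by auto
  \<comment> \<open>The odd exponent \<open>d\<close> may be negative; the sign is moved to the
    exponent of P0.\<close>
  have "x [^]\<^bsub>G\<^esub> (nat \<bar>d * int n\<bar>) = P0 [^]\<^bsub>G\<^esub> (if d * int n \<ge> 0 then i else - i)"
    using e x P0_in by (simp add: G.int_pow_neg flip: int_pow_int)
  moreover have "nat \<bar>d * int n\<bar> > 0" using \<open>d \<noteq> 0\<close> n(1) by simp
  ultimately show "\<exists>n::nat. n > 0 \<and> (\<exists>i::int. x [^]\<^bsub>G\<^esub> n = P0 [^]\<^bsub>G\<^esub> i)" by blast
qed

lemma ec_has_rank_1: "ec_has_rank (- 5 * of_int p :: rat) 0 1"
  using elliptic rank_1 unfolding ec_has_rank_def G_def q_def by simp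

end

theorem theorem1p2:
  fixes p :: nat
  assumes "Factorial_Ring.prime p" and "odd p"
    and "(\<exists>k\<^sub>1 m :: int. int p = 40 * k\<^sub>1 + 3 \<and> 5 * k\<^sub>1 + 1 = m ^ 2) \<or>
         (\<exists>k\<^sub>2 m :: int. int p = 40 * k\<^sub>2 + 27 \<and> 5 * k\<^sub>2 + 4 = m ^ 2)"
  shows "ec_has_rank (- 5 * of_nat p :: rat) 0 1"
proof -
  from assms(3) obtain k m :: int where
    "int p = 40 * k + 3 \<and> 5 * k + 1 = m\<^sup>2 \<or> int p = 40 * k + 27 \<and> 5 * k + 4 = m\<^sup>2" by blast
  \<comment> \<open>\<open>8 (5 k + 1) - 5 = 40 k + 3\<close> and
    \<open>8 (5 k + 4) - 5 = 40 k + 27\<close>.\<close>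
  then have p: "int p = 8 * m\<^sup>2 - 5" "int p = 40 * k + 3 \<or> int p = 40 * k + 27" by linarith+
  have "(40 * k + 3) mod 5 = 3" "(40 * k + 27) mod 5 = 2"
    by presburger+
  then have "int p mod 5 = 2 \<or> int p mod 5 = 3" using p(2) by auto
  moreover have "prime (int p)" using assms(1) by simp
  ultimately have "special_prime (int p) m" using p(1) by unfold_locales
  then show ?thesis using special_prime.ec_has_rank_1 by fastforce
qed

end
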